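(* For every network $G=(V,E)$ with capacities $(u_e)_{e\in E}$, source $s$, sink $t$, and every integer $\Gamma$ with $1\le\Gamma\le|E|$ (such that $Z_{\mathrm{LO}}\neq0$), $$\frac{Z_{\mathrm{RNI}}^{\mathrm{Path}}}{Z_{\mathrm{LO}}}\le 1+\frac{\lfloor\Gamma/2\rfloor\cdot\lceil\Gamma/2\rceil}{\Gamma+1}.$$ Moreover this bound is tight: for every integer $\Gamma\ge1$, the right-hand side is the supremum of the ratio over all networks.
   Context: $G=(V,E)$ is a finite directed graph (parallel arcs allowed) with capacities $u_e\in\mathbb R_+$ for $e\in E$, and distinct nodes $s$ (source) and $t$ (sink); no arc enters $s$ and no arc leaves $t$. $\delta^+(v)$ and $\delta^-(v)$ denote the sets of arcs leaving and entering $v$. $\Gamma$ is an integer with $1\le\Gamma\le|E|$. Path-based randomized network interdiction: $\Omega:=\{\mu\in\{0,1\}^{E}\mid\sum_{e\in E}\mu_e=\Gamma\}$ ($\mu_e=1$ means arc $e$ is removed); $\Delta(\Omega)$ is the set of probability distributions on $\Omega$; $\mathcal P$ is the set of all directed $s$-$t$-paths; $\mathcal X_P$ is the set of $x:\mathcal P\to\mathbb R_+$ with $\sum_{P\in\mathcal P:\,e\in P}x_P\le u_e$ for all $e\in E$; $g(\mu,x):=\sum_{P\in\mathcal P}\max\{0,1-\sum_{e\in P}\mu_e\}x_P$; and $Z_{\mathrm{RNI}}^{\mathrm{Path}}:=\min_{\alpha\in\Delta(\Omega)}\max_{x\in\mathcal X_P}\sum_{\mu\in\Omega}\alpha(\mu)g(\mu,x)$.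 LO model: for $\theta\ge0$, $Z_{\mathrm{LO}}(\theta)$ is the maximum of $\sum_{e\in\delta^-(t)}x_e-\Gamma\theta$ over $x\in\mathbb R^{E}$ with $\sum_{e\in\delta^+(v)}x_e-\sum_{e\in\delta^-(v)}x_e=0$ for all $v\in V\setminus\{s,t\}$, and $0\le x_e\le u_e$, $x_e\le\theta$ for all $e\in E$. Then $Z_{\mathrm{LO}}:=\max_{\theta\ge0}Z_{\mathrm{LO}}(\theta)$. *)

theory Defs
  imports "HOL-Probability.Probability" "Graph_Theory.Graph_Theory"
begin

text \<open>
  Parallel arcs are possible because arcs are a type of their own; \<open>fin_digraph\<close> also admits
  loops.  The capacity function is only constrained on \<open>arcs G\<close>; nothing below reads it elsewhere.
\<close>

locale flow_network = fin_digraph G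
  for G :: "('v, 'e) pre_digraph" +
  fixes u :: "'e \<Rightarrow> real" and s t :: 'v
  assumes source_in_verts: "s \<in> verts G"
    and sink_in_verts: "t \<in> verts G"
    and source_neq_sink: "s \<noteq> t"
    and no_arc_into_source: "in_arcs G s = {}"
    and no_arc_out_of_sink: "out_arcs G t = {}"
    and capacity_nonneg: "e \<in> arcs G \<Longrightarrow> 0 \<le> u e"

definition st_paths :: "('v, 'e) pre_digraph \<Rightarrow> 'v \<Rightarrow> 'v \<Rightarrow> 'e list set" where
  "st_paths G s t = {p. pre_digraph.apath G s p t}"

text \<open>
  Elements of \<open>interdictions\<close> are extensional functions, so that each vector in
  $\{0,1\}^E$ is represented once and the set is finite.
\<close>

definition interdictions :: "('v, 'e) pre_digraph \<Rightarrow> nat \<Rightarrow> ('e \<Rightarrow> real) set" where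
  "interdictions G \<Gamma> = {\<mu> \<in> arcs G \<rightarrow>\<^sub>E {0, 1}. (\<Sum>e\<in>arcs G. \<mu> e) = real \<Gamma>}"

definition mixed_interdictions :: "('v, 'e) pre_digraph \<Rightarrow> nat \<Rightarrow> ('e \<Rightarrow> real) pmf set" where
  "mixed_interdictions G \<Gamma> = {\<alpha>. set_pmf \<alpha> \<subseteq> interdictions G \<Gamma>}"

definition path_flows ::
  "('v, 'e) pre_digraph \<Rightarrow> ('e \<Rightarrow> real) \<Rightarrow> 'v \<Rightarrow> 'v \<Rightarrow> ('e list \<Rightarrow> real) set" where
  "path_flows G u s t =
    {x. (\<forall>p\<in>st_paths G s t. 0 \<le> x p) \<and>
        (\<forall>e\<in>arcs G. (\<Sum>p\<in>{p \<in> st_paths G s t. e \<in> set p}. x p) \<le> u e)}"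

definition surviving_flow ::
  "('v, 'e) pre_digraph \<Rightarrow> 'v \<Rightarrow> 'v \<Rightarrow> ('e \<Rightarrow> real) \<Rightarrow> ('e list \<Rightarrow> real) \<Rightarrow> real" where
  "surviving_flow G s t \<mu> x =
    (\<Sum>p\<in>st_paths G s t. max 0 (1 - (\<Sum>e\<in>set p. \<mu> e)) * x p)"

text \<open>
  In a \<open>flow_network\<close> with \<open>\<Gamma> \<le> card (arcs G)\<close>, all index sets below are nonempty and the objectives
  bounded in the relevant direction (every path has an arc, since \<open>s \<noteq> t\<close>), so these real-valued
  infima and suprema are the minima and maxima of linear optimization problems.
\<close>

definition Z_RNI_path ::
  "('v, 'e) pre_digraph \<Rightarrow> ('e \<Rightarrow> real) \<Rightarrow> 'v \<Rightarrow> 'v \<Rightarrow> nat \<Rightarrow> real" where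
  "Z_RNI_path G u s t \<Gamma> =
    (INF \<alpha>\<in>mixed_interdictions G \<Gamma>.
      SUP x\<in>path_flows G u s t.
        \<Sum>\<mu>\<in>interdictions G \<Gamma>. pmf \<alpha> \<mu> * surviving_flow G s t \<mu> x)"

definition LO_flows ::
  "('v, 'e) pre_digraph \<Rightarrow> ('e \<Rightarrow> real) \<Rightarrow> 'v \<Rightarrow> 'v \<Rightarrow> real \<Rightarrow> ('e \<Rightarrow> real) set" where
  "LO_flows G u s t \<theta> =
    {x. (\<forall>v \<in> verts G - {s, t}. (\<Sum>e\<in>out_arcs G v. x e) - (\<Sum>e\<in>in_arcs G v. x e) = 0) \<and>
        (\<forall>e\<in>arcs G. 0 \<le> x e \<and> x e \<le> u e \<and> x e \<le> \<theta>)}"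

definition Z_LO_at ::
  "('v, 'e) pre_digraph \<Rightarrow> ('e \<Rightarrow> real) \<Rightarrow> 'v \<Rightarrow> 'v \<Rightarrow> nat \<Rightarrow> real \<Rightarrow> real" where
  "Z_LO_at G u s t \<Gamma> \<theta> =
    (SUP x\<in>LO_flows G u s t \<theta>. (\<Sum>e\<in>in_arcs G t. x e) - real \<Gamma> * \<theta>)"

definition Z_LO :: "('v, 'e) pre_digraph \<Rightarrow> ('e \<Rightarrow> real) \<Rightarrow> 'v \<Rightarrow> 'v \<Rightarrow> nat \<Rightarrow> real" where
  "Z_LO G u s t \<Gamma> = (SUP \<theta>\<in>{0..}. Z_LO_at G u s t \<Gamma> \<theta>)"

definition LO_ratio_bound :: "nat \<Rightarrow> real" where
  "LO_ratio_bound \<Gamma> =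
    1 + real_of_int (\<lfloor>real \<Gamma> / 2\<rfloor> * \<lceil>real \<Gamma> / 2\<rceil>) / (real \<Gamma> + 1)"

end

theory Submission
  imports Defs
begin

text \<open>
  Upper bound.  By max-flow min-cut, every threshold \<open>\<theta>\<close> admits a cut \<open>C\<close> with
  \<open>(\<Sum>e\<in>C. min (u e) \<theta>) - \<Gamma> * \<theta> \<le> Z\<close>, where \<open>Z\<close> is the value of the LO model.  At a suitable \<open>\<theta>\<close>
  there are two such cuts, one with \<open>\<Gamma> - a\<close> and one with \<open>\<Gamma> + b\<close> wide arcs, whose narrow arcs have total
  capacity at most \<open>Z + a * \<theta>\<close> and \<open>Z - b * \<theta>\<close>, respectively.  Removing all wide arcs of the first cut
  and \<open>a\<close> random wide arcs of the second one limits the expected flow to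
  \<open>Z + \<theta> * a * (\<Gamma> - a) / (\<Gamma> + b)\<close>, and \<open>b * \<theta> \<le> Z\<close>.

  Tightness.  Two consecutive layers of parallel arcs realize \<open>b = 1\<close> and \<open>Z = \<theta>\<close>; splitting the narrow
  arcs of the first layer into ever smaller pieces makes removing them worthless.
\<close>

section \<open>Maximum flows and minimum cuts\<close>

definition cut_arcs :: "('v, 'e) pre_digraph \<Rightarrow> 'v set \<Rightarrow> 'e set" where
  "cut_arcs G R = {e \<in> arcs G. tail G e \<in> R \<and> head G e \<notin> R}"

definition inflow_excess :: "('v, 'e) pre_digraph \<Rightarrow> ('e \<Rightarrow> real) \<Rightarrow> 'v \<Rightarrow> real" where
  "inflow_excess G x v = (\<Sum>e\<in>in_arcs G v. x e) - (\<Sum>e\<in>out_arcs G v. x e)"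

context fin_digraph
begin

lemma inflow_excess_linear:
  "inflow_excess G (\<lambda>e. x e + c * d e) v = inflow_excess G x v + c * inflow_excess G d v"
  by (simp add: inflow_excess_def sum.distrib sum_distrib_left algebra_simps)

text \<open>For a loop the two corrections cancel, so no case distinction on the ends of
  \<open>e\<close> is needed.\<close>

lemma inflow_excess_upd:
  assumes "e \<in> arcs G"
  shows "inflow_excess G (d(e := d e + c)) v
    = inflow_excess G d v + (if v = head G e then c else 0) - (if v = tail G e then c else 0)"
proof -
  have upd: "(\<Sum>i\<in>A. (d(e := d e + c)) i) = (\<Sum>i\<in>A. d i) + (if e \<in> A then c else 0)"
    if "finite A" for A
  proof -
    have "(\<Sum>i\<in>A. (d(e := d e + c)) i) = (\<Sum>i\<in>A. d i + (if i = e then c else 0))"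
      by (rule sum.cong) auto
    then show ?thesis using that by (simp add: sum.distrib)
  qed
  show ?thesis
    using assms unfolding inflow_excess_def upd[OF finite_in_arcs] upd[OF finite_out_arcs] by auto
qed

text \<open>An arc with both ends in \<open>S\<close> is counted once as entering and once as
  leaving, so only the arcs crossing the boundary of \<open>S\<close> remain.\<close>

lemma sum_inflow_excess:
  assumes "S \<subseteq> verts G"
  shows "(\<Sum>v\<in>S. inflow_excess G x v)
    = (\<Sum>e\<in>{e \<in> arcs G. head G e \<in> S \<and> tail G e \<notin> S}. x e)
      - (\<Sum>e\<in>{e \<in> arcs G. tail G e \<in> S \<and> head G e \<notin> S}. x e)"
proof -
  have fin: "finite S" using assms finite_verts by (rule finite_subset)
  have "(\<Sum>v\<in>S. \<Sum>e\<in>in_arcs G v. x e) = (\<Sum>e\<in>{e \<in> arcs G. head G e \<in> S}. x e)"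
    using fin by (subst sum.group[symmetric, of _ S "head G"]) (auto intro!: sum.cong)
  moreover have "(\<Sum>v\<in>S. \<Sum>e\<in>out_arcs G v. x e) = (\<Sum>e\<in>{e \<in> arcs G. tail G e \<in> S}. x e)"
    using fin by (subst sum.group[symmetric, of _ S "tail G"]) (auto intro!: sum.cong)
  moreover have "(\<Sum>e\<in>{e \<in> arcs G. head G e \<in> S}. x e) =
     (\<Sum>e\<in>{e \<in> arcs G. head G e \<in> S \<and> tail G e \<in> S}. x e)
     + (\<Sum>e\<in>{e \<in> arcs G. head G e \<in> S \<and> tail G e \<notin> S}. x e)"
    by (subst sum.union_disjoint[symmetric]) (auto intro!: sum.cong)
  moreover have "(\<Sum>e\<in>{e \<in> arcs G. tail G e \<in> S}. x e) =
     (\<Sum>e\<in>{e \<in> arcs G. head G e \<in> S \<and> tail G e \<in> S}. x e)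
     + (\<Sum>e\<in>{e \<in> arcs G. tail G e \<in> S \<and> head G e \<notin> S}. x e)"
    by (subst sum.union_disjoint[symmetric]) (auto intro!: sum.cong)
  ultimately show ?thesis
    by (simp add: inflow_excess_def sum_subtractf)
qed

end

context flow_network
begin

text \<open>The caps are a parameter because the LO model is a flow problem with caps
  \<open>min (u e) \<theta>\<close> for each fixed \<open>\<theta>\<close>.\<close>

definition capped_flows :: "('e \<Rightarrow> real) \<Rightarrow> ('e \<Rightarrow> real) set" where
  "capped_flows c =
    {x. (\<forall>v\<in>verts G - {s, t}. inflow_excess G x v = 0) \<and> (\<forall>e\<in>arcs G. 0 \<le> x e \<and> x e \<le> c e)}"

text \<open>Compactness: the feasible flows form a closed subset of a compact box, on which the
  continuous flow value attains its maximum.\<close>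

lemma max_flow_exists:
  assumes c: "\<And>e. e \<in> arcs G \<Longrightarrow> 0 \<le> c e"
  obtains x where "x \<in> capped_flows c"
    "\<And>y. y \<in> capped_flows c \<Longrightarrow> (\<Sum>e\<in>in_arcs G t. y e) \<le> (\<Sum>e\<in>in_arcs G t. x e)"
proof -
  \<comment> \<open>Coordinates outside \<open>arcs G\<close> are pinned to 0, so that the box is
    compact in the space of all functions on the arc type.\<close>
  define K where "K = PiE UNIV (\<lambda>e. if e \<in> arcs G then {0..c e} else {0::real})"
  define F where "F = K \<inter> {x. \<forall>v\<in>verts G - {s, t}. inflow_excess G x v = 0}"
  have "compactin (product_topology (\<lambda>_. euclidean) UNIV) K"
    unfolding K_def by (subst compactin_PiE) auto
  then have "compact K"
    by (simp add: euclidean_product_topology)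
  moreover have "closed {x. \<forall>v\<in>verts G - {s, t}. inflow_excess G x v = 0}"
    unfolding inflow_excess_def Ball_def
    by (intro closed_Collect_all closed_Collect_imp closed_Collect_eq open_Collect_const
        continuous_intros continuous_on_product_coordinates)
  ultimately have "compact F"
    unfolding F_def by (rule compact_Int_closed)
  moreover have "(\<lambda>_. 0) \<in> F"
    using c by (auto simp: F_def K_def inflow_excess_def)
  moreover have "continuous_on F (\<lambda>x. \<Sum>e\<in>in_arcs G t. x e)"
    by (auto intro!: continuous_intros intro: continuous_on_subset[OF continuous_on_product_coordinates])
  ultimately obtain x where x: "x \<in> F"
    and max: "\<And>y. y \<in> F \<Longrightarrow> (\<Sum>e\<in>in_arcs G t. y e) \<le> (\<Sum>e\<in>in_arcs G t. x e)"
    using continuous_attains_sup[of F "\<lambda>x. \<Sum>e\<in>in_arcs G t. x e"] by blast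
  have "x e \<in> (if e \<in> arcs G then {0..c e} else {0})" for e
    using x by (auto simp: F_def K_def PiE_def Pi_def)
  then have "\<forall>e\<in>arcs G. 0 \<le> x e \<and> x e \<le> c e"
    by (metis atLeastAtMost_iff)
  then have "x \<in> capped_flows c"
    using x by (auto simp: F_def capped_flows_def)
  moreover have "(\<Sum>e\<in>in_arcs G t. y e) \<le> (\<Sum>e\<in>in_arcs G t. x e)" if y: "y \<in> capped_flows c" for y
  proof -
    \<comment> \<open>A competitor may take any values outside \<open>arcs G\<close>; resetting
      these to 0 puts it into \<open>F\<close> and leaves all sums over arcs unchanged.\<close>
    define z where "z = (\<lambda>e. if e \<in> arcs G then y e else 0)"
    have in_eq: "(\<Sum>e\<in>in_arcs G v. z e) = (\<Sum>e\<in>in_arcs G v. y e)" for v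
      by (rule sum.cong) (auto simp: z_def)
    have out_eq: "(\<Sum>e\<in>out_arcs G v. z e) = (\<Sum>e\<in>out_arcs G v. y e)" for v
      by (rule sum.cong) (auto simp: z_def)
    have "z \<in> F"
      using y unfolding F_def capped_flows_def inflow_excess_def
      by (auto simp: in_eq out_eq) (auto simp: K_def z_def)
    from max[OF this] show ?thesis by (simp add: in_eq)
  qed
  ultimately show ?thesis using that by blast
qed

text \<open>
  A direction pushing one unit from \<open>s\<close> to \<open>v\<close> in the residual network.  Such directions form a
  cone, so a single arc is appended without ever speaking about augmenting paths or step lengths.
\<close>

definition residual_direction :: "('e \<Rightarrow> real) \<Rightarrow> ('e \<Rightarrow> real) \<Rightarrow> 'v \<Rightarrow> ('e \<Rightarrow> real) \<Rightarrow> bool" where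
  "residual_direction c x v d \<longleftrightarrow>
    (\<forall>e\<in>arcs G. (x e \<le> 0 \<longrightarrow> 0 \<le> d e) \<and> (c e \<le> x e \<longrightarrow> d e \<le> 0)) \<and>
    (\<forall>w. inflow_excess G d w = (if w = v then 1 else 0) - (if w = s then 1 else 0))"

text \<open>\<open>R\<close> collects the vertices that a maximum flow can reach by a residual
  direction. Maximality keeps \<open>t\<close> outside, and closure of \<open>R\<close> under
  residual arcs makes leaving arcs saturated and entering arcs empty, so the flow value equals the
  capacity of the cut.\<close>

lemma max_flow_min_cut:
  assumes c: "\<And>e. e \<in> arcs G \<Longrightarrow> 0 \<le> c e"
  obtains x R where "x \<in> capped_flows c" "s \<in> R" "t \<notin> R" "R \<subseteq> verts G"
    "(\<Sum>e\<in>in_arcs G t. x e) = (\<Sum>e\<in>cut_arcs G R. c e)"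
proof -
  obtain x where x: "x \<in> capped_flows c"
    and max: "\<And>y. y \<in> capped_flows c \<Longrightarrow> (\<Sum>e\<in>in_arcs G t. y e) \<le> (\<Sum>e\<in>in_arcs G t. x e)"
    by (rule max_flow_exists[OF c]) blast+
  have x_bounds: "0 \<le> x e" "x e \<le> c e" if "e \<in> arcs G" for e
    using x that by (auto simp: capped_flows_def)
  define R where "R = {v \<in> verts G. \<exists>d. residual_direction c x v d}"
  have "s \<in> R"
    unfolding R_def using source_in_verts
    by (auto simp: residual_direction_def inflow_excess_def intro!: exI[of _ "\<lambda>_. 0"])
  have "t \<notin> R"
  proof
    assume "t \<in> R"
    then obtain d where d: "residual_direction c x t d" by (auto simp: R_def)
    \<comment> \<open>On a tight bound the sign condition on \<open>d\<close> keeps the arc feasible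
      for every positive step; on a slack bound continuity does so for small steps. As there are
      finitely many arcs, one step length serves all.\<close>
    have "\<exists>\<epsilon>>0. \<forall>e\<in>arcs G. 0 \<le> x e + \<epsilon> * d e \<and> x e + \<epsilon> * d e \<le> c e"
    proof -
      have "\<forall>\<^sub>F \<epsilon> in at_right (0::real). 0 \<le> x e + \<epsilon> * d e \<and> x e + \<epsilon> * d e \<le> c e"
        if e: "e \<in> arcs G" for e
      proof -
        have lim: "((\<lambda>\<epsilon>. x e + \<epsilon> * d e) \<longlongrightarrow> x e) (at_right 0)"
          by (auto intro!: tendsto_eq_intros)
        have pos: "\<forall>\<^sub>F \<epsilon> in at_right (0::real). 0 < \<epsilon>"
          by (simp add: eventually_at_right_less)
        have "\<forall>\<^sub>F \<epsilon> in at_right 0. 0 \<le> x e + \<epsilon> * d e"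
        proof (cases "x e \<le> 0")
          case True
          then have "0 \<le> d e" "x e = 0"
            using d e x_bounds[OF e] by (auto simp: residual_direction_def)
          with x_bounds[OF e] show ?thesis by (intro eventually_mono[OF pos]) simp
        next
          case False
          then have "\<forall>\<^sub>F \<epsilon> in at_right 0. 0 < x e + \<epsilon> * d e"
            using order_tendstoD(1)[OF lim] by simp
          then show ?thesis by (rule eventually_mono) simp
        qed
        moreover have "\<forall>\<^sub>F \<epsilon> in at_right 0. x e + \<epsilon> * d e \<le> c e"
        proof (cases "c e \<le> x e")
          case True
          then have "d e \<le> 0" "x e = c e"
            using d e x_bounds[OF e] by (auto simp: residual_direction_def)
          with x_bounds[OF e] show ?thesis by (intro eventually_mono[OF pos]) (simp add: mult_le_0_iff)
        next
          case False
          then have "\<forall>\<^sub>F \<epsilon> in at_right 0. x e + \<epsilon> * d e < c e"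
            using order_tendstoD(2)[OF lim] by simp
          then show ?thesis by (rule eventually_mono) simp
        qed
        ultimately show ?thesis by (rule eventually_conj)
      qed
      then have "\<forall>\<^sub>F \<epsilon> in at_right (0::real).
          \<forall>e\<in>arcs G. 0 \<le> x e + \<epsilon> * d e \<and> x e + \<epsilon> * d e \<le> c e"
        by (simp add: eventually_ball_finite_distrib)
      then have "\<forall>\<^sub>F \<epsilon> in at_right (0::real). 0 < \<epsilon> \<and>
          (\<forall>e\<in>arcs G. 0 \<le> x e + \<epsilon> * d e \<and> x e + \<epsilon> * d e \<le> c e)"
        using eventually_at_right_less by (rule eventually_conj[rotated])
      then show ?thesis
        using eventually_happens' trivial_limit_at_right_real by blast
    qed
    then obtain \<epsilon> where \<epsilon>: "\<epsilon> > 0"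
      "\<forall>e\<in>arcs G. 0 \<le> x e + \<epsilon> * d e \<and> x e + \<epsilon> * d e \<le> c e" by blast
    have "(\<lambda>e. x e + \<epsilon> * d e) \<in> capped_flows c"
      using x d \<epsilon> by (auto simp: capped_flows_def inflow_excess_linear residual_direction_def)
    from max[OF this] have "\<epsilon> * (\<Sum>e\<in>in_arcs G t. d e) \<le> 0"
      by (simp add: sum.distrib sum_distrib_left)
    moreover have "(\<Sum>e\<in>in_arcs G t. d e) = 1"
    proof -
      have "inflow_excess G d t = 1"
        using d source_neq_sink by (simp add: residual_direction_def)
      then show ?thesis using no_arc_out_of_sink by (simp add: inflow_excess_def)
    qed
    ultimately show False using \<epsilon> by simp
  qed
  have saturated: "x e = c e" if e: "e \<in> arcs G" "tail G e \<in> R" "head G e \<notin> R" for e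
  proof (rule ccontr)
    assume "x e \<noteq> c e"
    then have lt: "x e < c e" using x_bounds[OF e(1)] by simp
    obtain d where d: "residual_direction c x (tail G e) d" using e by (auto simp: R_def)
    \<comment> \<open>An unsaturated arc leaving \<open>R\<close> prolongs the direction from its
      tail to its head. The sign condition survives: raising \<open>d e\<close> is allowed since
      \<open>x e < c e\<close>.\<close>
    let ?d = "d(e := d e + 1)"
    have ends: "tail G e \<noteq> head G e" using e by auto
    have "0 \<le> d e + 1" if "x e \<le> 0"
      using d e that by (fastforce simp: residual_direction_def)
    then have "\<forall>a\<in>arcs G. (x a \<le> 0 \<longrightarrow> 0 \<le> ?d a) \<and> (c a \<le> x a \<longrightarrow> ?d a \<le> 0)"
      using d lt by (simp add: residual_direction_def)
    moreover have "inflow_excess G ?d w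
        = (if w = head G e then 1 else 0) - (if w = s then 1 else 0)" for w
      using d ends unfolding inflow_excess_upd[OF e(1)] residual_direction_def by auto
    ultimately have "residual_direction c x (head G e) ?d"
      unfolding residual_direction_def by blast
    then show False using e by (auto simp: R_def)
  qed
  have empty: "x e = 0" if e: "e \<in> arcs G" "head G e \<in> R" "tail G e \<notin> R" for e
  proof (rule ccontr)
    assume "x e \<noteq> 0"
    then have gt: "x e > 0" using x_bounds[OF e(1)] by simp
    obtain d where d: "residual_direction c x (head G e) d" using e by (auto simp: R_def)
    \<comment> \<open>Symmetrically, an entering arc with positive flow is traversed backwards by
      reducing its flow.\<close>
    let ?d = "d(e := d e + (-1))"
    have ends: "head G e \<noteq> tail G e" using e by auto
    have "d e + (-1) \<le> 0" if "c e \<le> x e"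
      using d e that by (fastforce simp: residual_direction_def)
    then have "\<forall>a\<in>arcs G. (x a \<le> 0 \<longrightarrow> 0 \<le> ?d a) \<and> (c a \<le> x a \<longrightarrow> ?d a \<le> 0)"
      using d gt by (simp add: residual_direction_def)
    moreover have "inflow_excess G ?d w
        = (if w = tail G e then 1 else 0) - (if w = s then 1 else 0)" for w
      using d ends unfolding inflow_excess_upd[OF e(1)] residual_direction_def by auto
    ultimately have "residual_direction c x (tail G e) ?d"
      unfolding residual_direction_def by blast
    then show False using e by (auto simp: R_def)
  qed
  let ?S = "verts G - R"
  \<comment> \<open>Outside \<open>R\<close> only \<open>t\<close> violates conservation, so the
    flow value is the net flow across the cut.\<close>
  have "(\<Sum>v\<in>?S. inflow_excess G x v) = (\<Sum>v\<in>{t}. inflow_excess G x v)"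
    using x \<open>s \<in> R\<close> \<open>t \<notin> R\<close> sink_in_verts
    by (intro sum.mono_neutral_right) (auto simp: capped_flows_def)
  also have "\<dots> = (\<Sum>e\<in>in_arcs G t. x e)"
    using no_arc_out_of_sink by (simp add: inflow_excess_def)
  finally have "(\<Sum>e\<in>in_arcs G t. x e)
    = (\<Sum>e\<in>{e \<in> arcs G. head G e \<in> ?S \<and> tail G e \<notin> ?S}. x e)
      - (\<Sum>e\<in>{e \<in> arcs G. tail G e \<in> ?S \<and> head G e \<notin> ?S}. x e)"
    by (simp add: sum_inflow_excess)
  also have "(\<Sum>e\<in>{e \<in> arcs G. tail G e \<in> ?S \<and> head G e \<notin> ?S}. x e) = 0"
    by (rule sum.neutral) (auto intro: empty)
  also have "(\<Sum>e\<in>{e \<in> arcs G. head G e \<in> ?S \<and> tail G e \<notin> ?S}. x e) = (\<Sum>e\<in>cut_arcs G R. c e)"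
    by (rule sum.cong) (auto simp: cut_arcs_def R_def intro: saturated[unfolded R_def])
  finally show ?thesis
    using that[OF x \<open>s \<in> R\<close> \<open>t \<notin> R\<close>] by (simp add: R_def)
qed

end

section \<open>The upper bound\<close>

text \<open>A uniformly random \<open>a\<close>-subset of \<open>B\<close> misses a given element
  with probability \<open>1 - a / card B\<close>; this is the form of that fact without division. It
  will bound the survival of a path through a wide arc of the second cut.\<close>

lemma card_subsets_avoiding:
  assumes B: "finite B" "f \<in> B"
  shows "card B * card {T. T \<subseteq> B \<and> card T = a \<and> f \<notin> T} = (card B - a) * (card B choose a)"
proof -
  have "{T. T \<subseteq> B \<and> card T = a \<and> f \<notin> T} = {T. T \<subseteq> B - {f} \<and> card T = a}" by auto
  then have "card {T. T \<subseteq> B \<and> card T = a \<and> f \<notin> T} = (card B - 1) choose a"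
    using B by (simp add: n_subsets)
  then show ?thesis by (simp add: binomial_absorb_comp)
qed

lemma floor_ceiling_half:
  "real_of_int (\<lfloor>real \<Gamma> / 2\<rfloor> * \<lceil>real \<Gamma> / 2\<rceil>) = real (\<Gamma> div 2) * (real \<Gamma> - real (\<Gamma> div 2))"
proof -
  have "\<lfloor>real \<Gamma> / 2\<rfloor> = int (\<Gamma> div 2)" "\<lceil>real \<Gamma> / 2\<rceil> = int \<Gamma> - int (\<Gamma> div 2)"
    by linarith+
  then show ?thesis by simp
qed

text \<open>With \<open>h = \<Gamma> div 2\<close>, \<open>r = \<Gamma> mod 2\<close> and
  \<open>d = h - a\<close>, the right side minus the left side is \<open>d * (d + r)\<close>. This
  is nonnegative because \<open>d\<close> is an integer and \<open>r\<close> is 0 or 1.\<close>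

lemma half_product_bound:
  "real a * (real \<Gamma> - real a) \<le> real_of_int (\<lfloor>real \<Gamma> / 2\<rfloor> * \<lceil>real \<Gamma> / 2\<rceil>)"
proof -
  define d where "d = int (\<Gamma> div 2) - int a"
  have "0 \<le> d * (d + int (\<Gamma> mod 2))"
    by (cases "0 \<le> d") (auto intro!: mult_nonneg_nonneg mult_nonpos_nonpos)
  then have "real_of_int 0 \<le> real_of_int (d * (d + int (\<Gamma> mod 2)))" by (simp only: of_int_le_iff)
  moreover have "real \<Gamma> = 2 * real (\<Gamma> div 2) + real (\<Gamma> mod 2)"
    by (metis mult_div_mod_eq of_nat_add of_nat_mult of_nat_numeral)
  ultimately show ?thesis
    unfolding floor_ceiling_half by (simp add: d_def algebra_simps)
qed

lemma LO_ratio_bound_ge_1: "1 \<le> LO_ratio_bound \<Gamma>"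
  using half_product_bound[of 0 \<Gamma>] by (simp add: LO_ratio_bound_def)

section \<open>Expected flow under a fixed mixed interdiction\<close>

definition expected_flow ::
  "('v, 'e) pre_digraph \<Rightarrow> 'v \<Rightarrow> 'v \<Rightarrow> nat \<Rightarrow> ('e \<Rightarrow> real) pmf \<Rightarrow> ('e list \<Rightarrow> real) \<Rightarrow> real" where
  "expected_flow G s t \<Gamma> \<alpha> x = (\<Sum>\<mu>\<in>interdictions G \<Gamma>. pmf \<alpha> \<mu> * surviving_flow G s t \<mu> x)"

text \<open>For a 0-1 vector the weight is 1 on an intact path and 0 on a damaged one, so for a path
  \<open>p\<close> and \<open>\<alpha>\<close> in \<open>mixed_interdictions\<close> this is the
  probability that \<open>p\<close> stays intact.\<close>

definition survival ::
  "('v, 'e) pre_digraph \<Rightarrow> nat \<Rightarrow> ('e \<Rightarrow> real) pmf \<Rightarrow> 'e list \<Rightarrow> real" where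
  "survival G \<Gamma> \<alpha> p = (\<Sum>\<mu>\<in>interdictions G \<Gamma>. pmf \<alpha> \<mu> * max 0 (1 - (\<Sum>e\<in>set p. \<mu> e)))"

text \<open>\<open>restrict\<close> produces the extensional representative that
  \<open>interdictions\<close> demands.\<close>

definition removal :: "('v, 'e) pre_digraph \<Rightarrow> 'e set \<Rightarrow> 'e \<Rightarrow> real" where
  "removal G S = restrict (indicator S) (arcs G)"

text \<open>Exchanging the sums turns the inner maximization into a packing linear program with
  survival probabilities as objective coefficients.\<close>

lemma expected_flow_eq:
  "expected_flow G s t \<Gamma> \<alpha> x = (\<Sum>p\<in>st_paths G s t. survival G \<Gamma> \<alpha> p * x p)"
  unfolding expected_flow_def survival_def surviving_flow_def sum_distrib_left sum_distrib_right
  by (subst sum.swap) (simp add: mult.assoc)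

lemma (in fin_digraph) finite_interdictions [simp]: "finite (interdictions G \<Gamma>)"
  unfolding interdictions_def
  by (rule finite_subset[of _ "arcs G \<rightarrow>\<^sub>E {0, 1}"]) (auto intro: finite_PiE)

lemma (in fin_digraph) finite_st_paths [simp]: "finite (st_paths G s t)"
  unfolding st_paths_def by (rule apaths_finite)

lemma st_path_arcs: "p \<in> st_paths G s t \<Longrightarrow> set p \<subseteq> arcs G"
  by (simp add: st_paths_def pre_digraph.apath_def pre_digraph.awalk_def)

lemma cas_crosses_cut:
  assumes "pre_digraph.cas G v p w" "set p \<subseteq> arcs G" "v \<in> R" "w \<notin> R"
  shows "\<exists>e\<in>set p. e \<in> cut_arcs G R"
  using assms
proof (induction p arbitrary: v)
  case Nil
  then show ?case by (simp add: pre_digraph.cas.simps)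
next
  case (Cons e p)
  then have e: "tail G e = v" "pre_digraph.cas G (head G e) p w" "e \<in> arcs G"
    by (auto simp: pre_digraph.cas.simps)
  show ?case
  proof (cases "head G e \<in> R")
    case True
    then show ?thesis using Cons.IH[OF e(2)] Cons.prems by auto
  next
    case False
    then show ?thesis using e Cons.prems by (auto simp: cut_arcs_def)
  qed
qed

lemma st_path_crosses_cut:
  assumes "p \<in> st_paths G s t" "s \<in> R" "t \<notin> R"
  shows "\<exists>e\<in>set p. e \<in> cut_arcs G R"
  using assms cas_crosses_cut[of G s p t R]
  by (auto simp: st_paths_def pre_digraph.apath_def pre_digraph.awalk_def)

lemma (in fin_digraph) finite_cut_arcs [simp]: "finite (cut_arcs G R)"
  by (simp add: cut_arcs_def)

context fin_digraph
begin

lemma removal_in_interdictions: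
  assumes "S \<subseteq> arcs G" "card S = \<Gamma>"
  shows "removal G S \<in> interdictions G \<Gamma>"
proof -
  have "(\<Sum>e\<in>arcs G. removal G S e) = (\<Sum>e\<in>arcs G. indicator S e)"
    by (rule sum.cong) (auto simp: removal_def)
  also have "\<dots> = real (card S)"
    using assms(1) by (simp add: indicator_def Int_absorb1 flip: sum.inter_filter Int_def)
  finally show ?thesis
    using assms by (auto simp: interdictions_def removal_def indicator_def)
qed

lemma interdictions_nonempty:
  assumes "\<Gamma> \<le> card (arcs G)"
  shows "interdictions G \<Gamma> \<noteq> {}"
proof -
  obtain S where "S \<subseteq> arcs G" "card S = \<Gamma>"
    using assms by (meson obtain_subset_with_card_n)
  from removal_in_interdictions[OF this] show ?thesis by blast
qed

lemma survival_le_1: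
  assumes \<alpha>: "\<alpha> \<in> mixed_interdictions G \<Gamma>" and p: "set p \<subseteq> arcs G"
  shows "survival G \<Gamma> \<alpha> p \<le> 1"
proof -
  have "survival G \<Gamma> \<alpha> p \<le> (\<Sum>\<mu>\<in>interdictions G \<Gamma>. pmf \<alpha> \<mu> * 1)"
    unfolding survival_def
  proof (intro sum_mono mult_left_mono)
    fix \<mu> assume "\<mu> \<in> interdictions G \<Gamma>"
    then have "\<mu> e \<in> {0, 1}" if "e \<in> arcs G" for e
      using that by (auto simp: interdictions_def PiE_def Pi_def)
    then have "0 \<le> (\<Sum>e\<in>set p. \<mu> e)"
      using p by (intro sum_nonneg) fastforce
    then show "max 0 (1 - (\<Sum>e\<in>set p. \<mu> e)) \<le> 1" by simp
  qed simp
  also have "\<dots> = 1"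
    using \<alpha> by (simp add: mixed_interdictions_def sum_pmf_eq_1)
  finally show ?thesis .
qed

text \<open>Weak linear programming duality: arc weights \<open>y\<close> covering the survival
  probability of each path are a dual solution of the inner packing problem. Regrouping path flow by
  arcs lets the capacity constraints apply.\<close>

lemma expected_flow_le_dual:
  assumes x: "x \<in> path_flows G u s t"
    and y: "\<And>e. e \<in> arcs G \<Longrightarrow> 0 \<le> y e"
    and cover: "\<And>p. p \<in> st_paths G s t \<Longrightarrow> survival G \<Gamma> \<alpha> p \<le> (\<Sum>e\<in>set p. y e)"
  shows "expected_flow G s t \<Gamma> \<alpha> x \<le> (\<Sum>e\<in>arcs G. y e * u e)"
proof -
  have "expected_flow G s t \<Gamma> \<alpha> x \<le> (\<Sum>p\<in>st_paths G s t. (\<Sum>e\<in>set p. y e) * x p)"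
    unfolding expected_flow_eq using x cover
    by (intro sum_mono mult_right_mono) (auto simp: path_flows_def)
  also have "\<dots> = (\<Sum>p\<in>st_paths G s t. \<Sum>e\<in>{e \<in> arcs G. e \<in> set p}. y e * x p)"
  proof (intro sum.cong refl)
    fix p assume "p \<in> st_paths G s t"
    then have "{e \<in> arcs G. e \<in> set p} = set p" using st_path_arcs by fastforce
    then show "(\<Sum>e\<in>set p. y e) * x p = (\<Sum>e\<in>{e \<in> arcs G. e \<in> set p}. y e * x p)"
      by (simp add: sum_distrib_right)
  qed
  also have "\<dots> = (\<Sum>e\<in>arcs G. \<Sum>p\<in>{p \<in> st_paths G s t. e \<in> set p}. y e * x p)"
    by (rule sum.swap_restrict) auto
  also have "\<dots> = (\<Sum>e\<in>arcs G. y e * (\<Sum>p\<in>{p \<in> st_paths G s t. e \<in> set p}. x p))"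
    by (simp add: sum_distrib_left)
  also have "\<dots> \<le> (\<Sum>e\<in>arcs G. y e * u e)"
    using x y by (intro sum_mono mult_left_mono) (auto simp: path_flows_def)
  finally show ?thesis .
qed

text \<open>The random index \<open>T\<close> is kept apart from the removed set \<open>S T\<close>,
  so that the random choice can be completed to exactly \<Gamma> arcs without disturbing
  uniformity.\<close>

definition uniform_removal :: "('c \<Rightarrow> 'b set) \<Rightarrow> 'c set \<Rightarrow> ('b \<Rightarrow> real) pmf" where
  "uniform_removal S \<T> = map_pmf (\<lambda>T. removal G (S T)) (pmf_of_set \<T>)"

lemma uniform_removal_mixed:
  assumes "finite \<T>" "\<T> \<noteq> {}" "\<And>T. T \<in> \<T> \<Longrightarrow> S T \<subseteq> arcs G" "\<And>T. T \<in> \<T> \<Longrightarrow> card (S T) = \<Gamma>"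
  shows "uniform_removal S \<T> \<in> mixed_interdictions G \<Gamma>"
  using assms removal_in_interdictions by (auto simp: mixed_interdictions_def uniform_removal_def)

text \<open>Read as an expectation, the survival probability passes through \<open>map_pmf\<close>
  to an average over indices. The weight \<open>max 0 (1 - card (set p \<inter> S T))\<close>
  vanishes as soon as one arc of the path is removed, so this average counts the indices that miss
  the path.\<close>

lemma survival_uniform_removal_le:
  assumes \<T>: "finite \<T>" "\<T> \<noteq> {}" "\<And>T. T \<in> \<T> \<Longrightarrow> S T \<subseteq> arcs G" "\<And>T. T \<in> \<T> \<Longrightarrow> card (S T) = \<Gamma>"
    and p: "set p \<subseteq> arcs G"
  shows "survival G \<Gamma> (uniform_removal S \<T>) p \<le> card {T \<in> \<T>. set p \<inter> S T = {}} / card \<T>"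
proof -
  let ?\<alpha> = "uniform_removal S \<T>"
  let ?h = "\<lambda>\<mu>. max 0 (1 - (\<Sum>e\<in>set p. \<mu> e)) :: real"
  have "set_pmf ?\<alpha> \<subseteq> interdictions G \<Gamma>"
    using uniform_removal_mixed[OF \<T>] by (simp add: mixed_interdictions_def)
  then have "measure_pmf.expectation ?\<alpha> ?h = survival G \<Gamma> ?\<alpha> p"
    unfolding survival_def
    by (subst integral_measure_pmf_real[of "interdictions G \<Gamma>"]) (auto simp: mult.commute)
  moreover have "measure_pmf.expectation ?\<alpha> ?h = (\<Sum>T\<in>\<T>. ?h (removal G (S T))) / card \<T>"
    using \<T> by (simp add: uniform_removal_def integral_pmf_of_set)
  moreover have "?h (removal G (S T)) = (if set p \<inter> S T = {} then 1 else 0)" for T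
  proof -
    have "(\<Sum>e\<in>set p. removal G (S T) e) = (\<Sum>e\<in>set p. if e \<in> S T then 1 else 0)"
      using p by (intro sum.cong) (auto simp: removal_def)
    also have "\<dots> = real (card (set p \<inter> S T))"
      by (simp add: Int_def flip: sum.inter_filter)
    finally show ?thesis by (auto simp: card_gt_0_iff Suc_le_eq)
  qed
  then have "(\<Sum>T\<in>\<T>. ?h (removal G (S T))) = card {T \<in> \<T>. set p \<inter> S T = {}}"
    using \<T>(1) by (simp flip: sum.inter_filter)
  ultimately show ?thesis by simp
qed

end

context flow_network
begin

lemma st_path_nonempty: "p \<in> st_paths G s t \<Longrightarrow> p \<noteq> []"
  using source_neq_sink
  by (auto simp: st_paths_def pre_digraph.apath_def pre_digraph.awalk_def pre_digraph.cas.simps)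

lemma zero_path_flow: "(\<lambda>_. 0) \<in> path_flows G u s t"
  using capacity_nonneg by (auto simp: path_flows_def)

text \<open>Constant dual weight 1 suffices, since paths are nonempty and survive with probability
  at most 1. The bound makes the real-valued suprema over path flows meaningful.\<close>

lemma bdd_above_expected_flow:
  assumes "\<alpha> \<in> mixed_interdictions G \<Gamma>"
  shows "bdd_above (expected_flow G s t \<Gamma> \<alpha> ` path_flows G u s t)"
proof (rule bdd_aboveI2)
  fix x assume "x \<in> path_flows G u s t"
  then show "expected_flow G s t \<Gamma> \<alpha> x \<le> (\<Sum>e\<in>arcs G. 1 * u e)"
  proof (rule expected_flow_le_dual)
    fix p assume p: "p \<in> st_paths G s t"
    then have "1 \<le> card (set p)"
      using st_path_nonempty by (fastforce simp: Suc_le_eq card_gt_0_iff)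
    then show "survival G \<Gamma> \<alpha> p \<le> (\<Sum>e\<in>set p. 1)"
      using survival_le_1[OF assms st_path_arcs[OF p]] by simp
  qed simp
qed

section \<open>Bounding the interdiction value by single strategies\<close>

lemma Z_RNI_path_eq:
  "Z_RNI_path G u s t \<Gamma> =
    (INF \<alpha>\<in>mixed_interdictions G \<Gamma>. SUP x\<in>path_flows G u s t. expected_flow G s t \<Gamma> \<alpha> x)"
  by (simp add: Z_RNI_path_def expected_flow_def)

text \<open>One mixed interdiction certifies an upper bound. The real infimum also needs a lower
  bound on its family, which the zero flow supplies.\<close>

lemma Z_RNI_path_le:
  assumes \<alpha>: "\<alpha> \<in> mixed_interdictions G \<Gamma>"
    and le: "\<And>x. x \<in> path_flows G u s t \<Longrightarrow> expected_flow G s t \<Gamma> \<alpha> x \<le> z"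
  shows "Z_RNI_path G u s t \<Gamma> \<le> z"
  unfolding Z_RNI_path_eq
proof (rule cINF_lower2[OF _ \<alpha>])
  show "(SUP x\<in>path_flows G u s t. expected_flow G s t \<Gamma> \<alpha> x) \<le> z"
    using zero_path_flow le by (intro cSUP_least) auto
  have "0 \<le> (SUP x\<in>path_flows G u s t. expected_flow G s t \<Gamma> \<beta> x)"
    if "\<beta> \<in> mixed_interdictions G \<Gamma>" for \<beta>
    using cSUP_upper[OF zero_path_flow bdd_above_expected_flow[OF that]]
    by (simp add: expected_flow_eq)
  then show "bdd_below ((\<lambda>\<alpha>. SUP x\<in>path_flows G u s t. expected_flow G s t \<Gamma> \<alpha> x)
      ` mixed_interdictions G \<Gamma>)"
    by (rule bdd_belowI2)
qed

text \<open>A single flow that is good against every pure interdiction is, by averaging, good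
  against every mixed one.\<close>

lemma Z_RNI_path_ge:
  assumes \<Gamma>: "\<Gamma> \<le> card (arcs G)"
    and x: "x \<in> path_flows G u s t"
    and ge: "\<And>\<mu>. \<mu> \<in> interdictions G \<Gamma> \<Longrightarrow> z \<le> surviving_flow G s t \<mu> x"
  shows "z \<le> Z_RNI_path G u s t \<Gamma>"
  unfolding Z_RNI_path_eq
proof (rule cINF_greatest)
  obtain \<mu> where "\<mu> \<in> interdictions G \<Gamma>" using interdictions_nonempty[OF \<Gamma>] by blast
  then have "return_pmf \<mu> \<in> mixed_interdictions G \<Gamma>" by (simp add: mixed_interdictions_def)
  then show "mixed_interdictions G \<Gamma> \<noteq> {}" by blast
next
  fix \<alpha> assume \<alpha>: "\<alpha> \<in> mixed_interdictions G \<Gamma>"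
  have "z = (\<Sum>\<mu>\<in>interdictions G \<Gamma>. pmf \<alpha> \<mu> * z)"
    using \<alpha> by (simp add: mixed_interdictions_def sum_pmf_eq_1 flip: sum_distrib_right)
  also have "\<dots> \<le> expected_flow G s t \<Gamma> \<alpha> x"
    unfolding expected_flow_def using ge by (intro sum_mono mult_left_mono) auto
  also have "\<dots> \<le> (SUP x\<in>path_flows G u s t. expected_flow G s t \<Gamma> \<alpha> x)"
    by (rule cSUP_upper[OF x bdd_above_expected_flow[OF \<alpha>]])
  finally show "z \<le> (SUP x\<in>path_flows G u s t. expected_flow G s t \<Gamma> \<alpha> x)" .
qed

lemma Z_RNI_path_le_two_cuts:
  fixes a \<Gamma> :: nat and B1 B2 :: "'e set"
  defines "q \<equiv> real a / real (card B2)"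
  assumes \<Gamma>: "\<Gamma> \<le> card (arcs G)"
    and R1: "s \<in> R1" "t \<notin> R1" and B1: "B1 \<subseteq> cut_arcs G R1" "card B1 + a \<le> \<Gamma>"
    and R2: "s \<in> R2" "t \<notin> R2" and B2: "B2 \<subseteq> cut_arcs G R2" "a \<le> card B2"
  shows "Z_RNI_path G u s t \<Gamma>
    \<le> (1 - q) * (\<Sum>e\<in>cut_arcs G R1 - B1. u e) + q * (\<Sum>e\<in>cut_arcs G R2 - B2. u e)"
  \<comment> \<open>Remove \<open>B1\<close> and a uniformly random \<open>a\<close>-subset of \<open>B2\<close>.\<close>
proof -
  define \<T> where "\<T> = {T. T \<subseteq> B2 \<and> card T = a}"
  have fin: "finite B1" "finite B2"
    using B1(1) B2(1) by (auto intro: finite_subset[OF _ finite_cut_arcs])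
  have sub: "B1 \<subseteq> arcs G" "B2 \<subseteq> arcs G" using B1(1) B2(1) by (auto simp: cut_arcs_def)
  have \<T>: "finite \<T>" "card \<T> = card B2 choose a"
    using fin by (simp_all add: \<T>_def n_subsets)
  then have card_\<T>: "card \<T> > 0" using B2 by simp
  \<comment> \<open>If \<open>B2\<close> is empty then \<open>a = 0\<close>, and \<open>q\<close> is
    0 by the convention for division by zero.\<close>
  have q: "0 \<le> q" "q \<le> 1" using B2 by (auto simp: q_def divide_le_eq_1)
  \<comment> \<open>\<open>B1\<close> and \<open>T\<close> may overlap or leave budget unspent, so
    their union is filled up to exactly \<Gamma> arcs.\<close>
  have "\<exists>S'. B1 \<union> T \<subseteq> S' \<and> S' \<subseteq> arcs G \<and> card S' = \<Gamma>" if "T \<in> \<T>" for T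
  proof -
    have "card (B1 \<union> T) \<le> \<Gamma>"
      using card_Un_le[of B1 T] that B1 by (simp add: \<T>_def)
    then show ?thesis
      using exists_subset_between[of "B1 \<union> T" \<Gamma> "arcs G"] sub \<Gamma> that by (auto simp: \<T>_def)
  qed
  then obtain S where S: "\<And>T. T \<in> \<T> \<Longrightarrow> B1 \<union> T \<subseteq> S T" "\<And>T. T \<in> \<T> \<Longrightarrow> S T \<subseteq> arcs G"
    "\<And>T. T \<in> \<T> \<Longrightarrow> card (S T) = \<Gamma>"
    by metis
  have \<T>_ne: "\<T> \<noteq> {}" using card_\<T> by auto
  define \<alpha> where "\<alpha> = uniform_removal S \<T>"
  have \<alpha>: "\<alpha> \<in> mixed_interdictions G \<Gamma>"
    unfolding \<alpha>_def using \<T>(1) \<T>_ne S by (intro uniform_removal_mixed)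
  \<comment> \<open>Dual weights: a narrow arc of the first cut pays \<open>1 - q\<close> and one of
    the second cut pays \<open>q\<close>; an arc that is narrow in both pays both.\<close>
  define y where "y = (\<lambda>e. (1 - q) * indicator (cut_arcs G R1 - B1) e
    + q * indicator (cut_arcs G R2 - B2) e :: real)"
  have y_nonneg: "0 \<le> y e" for e using q by (simp add: y_def)
  have cover: "survival G \<Gamma> \<alpha> p \<le> (\<Sum>e\<in>set p. y e)" if p: "p \<in> st_paths G s t" for p
  proof -
    obtain e1 where e1: "e1 \<in> set p" "e1 \<in> cut_arcs G R1"
      using st_path_crosses_cut[OF p R1] by blast
    obtain e2 where e2: "e2 \<in> set p" "e2 \<in> cut_arcs G R2"
      using st_path_crosses_cut[OF p R2] by blast
    have surv: "survival G \<Gamma> \<alpha> p \<le> card {T \<in> \<T>. set p \<inter> S T = {}} / card \<T>"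
      unfolding \<alpha>_def using \<T>(1) \<T>_ne S st_path_arcs[OF p] by (intro survival_uniform_removal_le)
    have ge1: "indicator (cut_arcs G R1 - B1) e1 \<le> (\<Sum>e\<in>set p. indicator (cut_arcs G R1 - B1) e :: real)"
      using e1(1) by (intro member_le_sum) auto
    have ge2: "indicator (cut_arcs G R2 - B2) e2 \<le> (\<Sum>e\<in>set p. indicator (cut_arcs G R2 - B2) e :: real)"
      using e2(1) by (intro member_le_sum) auto
    have y_ge: "(1 - q) * indicator (cut_arcs G R1 - B1) e1 + q * indicator (cut_arcs G R2 - B2) e2
        \<le> (\<Sum>e\<in>set p. y e)"
      using q mult_left_mono[OF ge1, of "1 - q"] mult_left_mono[OF ge2, of q]
      by (simp add: y_def sum.distrib flip: sum_distrib_left)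
    \<comment> \<open>A path using a wide arc of the first cut is always hit. If \<open>e1\<close>
      is narrow and \<open>e2\<close> wide, the path survives with probability at most
      \<open>1 - q\<close>, paid by \<open>e1\<close>. If both are narrow, the weights add up to at
      least 1.\<close>
    consider "e1 \<in> B1" | "e1 \<notin> B1" "e2 \<in> B2" | "e1 \<notin> B1" "e2 \<notin> B2" by blast
    then show ?thesis
    proof cases
      case 1
      then have none: "{T \<in> \<T>. set p \<inter> S T = {}} = {}" using S(1) e1 by blast
      have "survival G \<Gamma> \<alpha> p \<le> 0" using surv unfolding none by simp
      also have "0 \<le> (\<Sum>e\<in>set p. y e)" using y_nonneg by (intro sum_nonneg)
      finally show ?thesis .
    next
      case 2
      have "{T \<in> \<T>. set p \<inter> S T = {}} \<subseteq> {T. T \<subseteq> B2 \<and> card T = a \<and> e2 \<notin> T}"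
        using S(1) e2 unfolding \<T>_def by blast
      then have "card {T \<in> \<T>. set p \<inter> S T = {}} \<le> card {T. T \<subseteq> B2 \<and> card T = a \<and> e2 \<notin> T}"
        using fin by (intro card_mono) auto
      then have "card B2 * card {T \<in> \<T>. set p \<inter> S T = {}} \<le> (card B2 - a) * card \<T>"
        unfolding \<T>(2) card_subsets_avoiding[OF fin(2) 2(2), of a, symmetric] by (rule mult_le_mono2)
      then have "real (card B2) * card {T \<in> \<T>. set p \<inter> S T = {}} \<le> (real (card B2) - real a) * card \<T>"
        unfolding of_nat_diff[OF B2(2), symmetric] of_nat_mult[symmetric] of_nat_le_iff .
      moreover have "card B2 > 0" using fin 2(2) by (auto simp: card_gt_0_iff)
      ultimately have "card {T \<in> \<T>. set p \<inter> S T = {}} / card \<T> \<le> 1 - q"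
        using card_\<T> by (simp add: q_def field_simps)
      moreover have "1 - q \<le> (\<Sum>e\<in>set p. y e)" using y_ge 2 e1 by simp
      ultimately show ?thesis using surv by linarith
    next
      case 3
      then have "1 \<le> (\<Sum>e\<in>set p. y e)" using y_ge e1 e2 by simp
      then show ?thesis using survival_le_1[OF \<alpha> st_path_arcs[OF p]] by linarith
    qed
  qed
  have "(\<Sum>e\<in>arcs G. y e * u e)
    = (1 - q) * (\<Sum>e\<in>cut_arcs G R1 - B1. u e) + q * (\<Sum>e\<in>cut_arcs G R2 - B2. u e)"
  proof -
    have ind: "(\<Sum>e\<in>arcs G. indicator A e * u e) = (\<Sum>e\<in>A. u e)" if "A \<subseteq> arcs G" for A
      by (rule sum.mono_neutral_cong_right) (use that in \<open>auto simp: indicator_def\<close>)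
    have "(\<Sum>e\<in>arcs G. y e * u e) = (1 - q) * (\<Sum>e\<in>arcs G. indicator (cut_arcs G R1 - B1) e * u e)
        + q * (\<Sum>e\<in>arcs G. indicator (cut_arcs G R2 - B2) e * u e)"
      by (simp only: y_def distrib_right sum.distrib sum_distrib_left mult.assoc)
    then show ?thesis by (subst (asm) (1 2) ind) (auto simp: cut_arcs_def)
  qed
  moreover have "Z_RNI_path G u s t \<Gamma> \<le> (\<Sum>e\<in>arcs G. y e * u e)"
    by (rule Z_RNI_path_le[OF \<alpha>], rule expected_flow_le_dual) (auto intro: y_nonneg cover)
  ultimately show ?thesis by simp
qed

section \<open>Values of the LO model and threshold cuts\<close>

lemma Z_LO_at_bound:
  assumes x: "x \<in> LO_flows G u s t \<theta>"
  shows "(\<Sum>e\<in>in_arcs G t. x e) \<le> (\<Sum>e\<in>arcs G. u e)"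
proof -
  have "(\<Sum>e\<in>in_arcs G t. x e) \<le> (\<Sum>e\<in>in_arcs G t. u e)"
    using x by (intro sum_mono) (auto simp: LO_flows_def)
  also have "\<dots> \<le> (\<Sum>e\<in>arcs G. u e)"
    using capacity_nonneg by (intro sum_mono2) auto
  finally show ?thesis .
qed

lemma zero_LO_flow: "0 \<le> \<theta> \<Longrightarrow> (\<lambda>_. 0) \<in> LO_flows G u s t \<theta>"
  using capacity_nonneg by (auto simp: LO_flows_def)

lemma Z_LO_upper:
  assumes \<theta>: "0 \<le> \<theta>" and x: "x \<in> LO_flows G u s t \<theta>"
  shows "(\<Sum>e\<in>in_arcs G t. x e) - real \<Gamma> * \<theta> \<le> Z_LO G u s t \<Gamma>"
proof -
  have bdd: "bdd_above ((\<lambda>x. (\<Sum>e\<in>in_arcs G t. x e) - real \<Gamma> * \<theta>) ` LO_flows G u s t \<theta>)" for \<theta>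
    using Z_LO_at_bound by (intro bdd_aboveI2[of _ _ "(\<Sum>e\<in>arcs G. u e) - real \<Gamma> * \<theta>"]) auto
  have "Z_LO_at G u s t \<Gamma> \<eta> \<le> (\<Sum>e\<in>arcs G. u e)" if \<eta>: "\<eta> \<in> {0..}" for \<eta>
    unfolding Z_LO_at_def
  proof (rule cSUP_least)
    show "LO_flows G u s t \<eta> \<noteq> {}" using zero_LO_flow \<eta> by fastforce
    fix y assume "y \<in> LO_flows G u s t \<eta>"
    moreover have "0 \<le> real \<Gamma> * \<eta>" using \<eta> by simp
    ultimately show "(\<Sum>e\<in>in_arcs G t. y e) - real \<Gamma> * \<eta> \<le> (\<Sum>e\<in>arcs G. u e)"
      using Z_LO_at_bound[of y \<eta>] by linarith
  qed
  then have "Z_LO_at G u s t \<Gamma> \<theta> \<le> Z_LO G u s t \<Gamma>"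
    unfolding Z_LO_def using \<theta> by (intro cSUP_upper bdd_aboveI2) auto
  moreover have "(\<Sum>e\<in>in_arcs G t. x e) - real \<Gamma> * \<theta> \<le> Z_LO_at G u s t \<Gamma> \<theta>"
    unfolding Z_LO_at_def by (rule cSUP_upper[OF x bdd])
  ultimately show ?thesis by linarith
qed

lemma Z_LO_le:
  assumes "\<And>\<theta> x. 0 \<le> \<theta> \<Longrightarrow> x \<in> LO_flows G u s t \<theta> \<Longrightarrow> (\<Sum>e\<in>in_arcs G t. x e) - real \<Gamma> * \<theta> \<le> z"
  shows "Z_LO G u s t \<Gamma> \<le> z"
  unfolding Z_LO_def Z_LO_at_def
proof (intro cSUP_least)
  show "LO_flows G u s t \<theta> \<noteq> {}" if "\<theta> \<in> {0..}" for \<theta> using zero_LO_flow that by fastforce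
qed (use assms in auto)

lemma Z_LO_nonneg: "0 \<le> Z_LO G u s t \<Gamma>"
  using Z_LO_upper[OF order_refl zero_LO_flow] by simp

text \<open>Capping each arc at \<open>min (u e) \<theta>\<close> merges both upper bounds of the LO
  model, so a maximum flow for these caps is feasible there and its minimum cut inherits the
  bound.\<close>

lemma threshold_cut:
  assumes \<theta>: "0 \<le> \<theta>"
  obtains R where "s \<in> R" "t \<notin> R" "R \<subseteq> verts G"
    "(\<Sum>e\<in>cut_arcs G R. min (u e) \<theta>) - real \<Gamma> * \<theta> \<le> Z_LO G u s t \<Gamma>"
proof -
  have "0 \<le> min (u e) \<theta>" if "e \<in> arcs G" for e using \<theta> capacity_nonneg[OF that] by simp
  then obtain x R where xR: "x \<in> capped_flows (\<lambda>e. min (u e) \<theta>)" "s \<in> R" "t \<notin> R" "R \<subseteq> verts G"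
    "(\<Sum>e\<in>in_arcs G t. x e) = (\<Sum>e\<in>cut_arcs G R. min (u e) \<theta>)"
    by (rule max_flow_min_cut)
  have "x \<in> LO_flows G u s t \<theta>"
    using xR(1) by (auto simp: capped_flows_def LO_flows_def inflow_excess_def)
  from Z_LO_upper[OF \<theta> this] show ?thesis using that xR by simp
qed

text \<open>\<open>B\<close> plays the wide arcs of the cut, but is not tied to any threshold. The
  family is thus finite and independent of \<theta>.\<close>

definition threshold_pairs :: "('v set \<times> 'e set) set" where
  "threshold_pairs = {(R, B). R \<subseteq> verts G \<and> s \<in> R \<and> t \<notin> R \<and> B \<subseteq> cut_arcs G R}"

lemma finite_threshold_pairs: "finite threshold_pairs"
  by (rule finite_subset[of _ "Pow (verts G) \<times> Pow (arcs G)"])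
    (auto simp: threshold_pairs_def cut_arcs_def)

text \<open>The capped cut value minus \<open>\<Gamma> * \<theta>\<close>, computed as if exactly
  the arcs of \<open>B\<close> were cut down to \<theta>. For a fixed pair it is affine in \<theta>,
  hence continuous.\<close>

definition threshold_value :: "nat \<Rightarrow> 'v set \<times> 'e set \<Rightarrow> real \<Rightarrow> real" where
  "threshold_value \<Gamma> = (\<lambda>(R, B) \<theta>. (\<Sum>e\<in>cut_arcs G R - B. u e) + (real (card B) - real \<Gamma>) * \<theta>)"

text \<open>Arcs of capacity exactly \<theta> may lie on either side, since both readings contribute
  \<theta>.\<close>

lemma min_cut_eq_threshold_value:
  assumes "B \<subseteq> cut_arcs G R" "\<And>e. e \<in> B \<Longrightarrow> \<theta> \<le> u e" "\<And>e. e \<in> cut_arcs G R - B \<Longrightarrow> u e \<le> \<theta>"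
  shows "(\<Sum>e\<in>cut_arcs G R. min (u e) \<theta>) - real \<Gamma> * \<theta> = threshold_value \<Gamma> (R, B) \<theta>"
proof -
  have "(\<Sum>e\<in>cut_arcs G R. min (u e) \<theta>)
      = (\<Sum>e\<in>cut_arcs G R - B. min (u e) \<theta>) + (\<Sum>e\<in>B. min (u e) \<theta>)"
    by (rule sum.subset_diff[OF assms(1)]) simp
  also have "\<dots> = (\<Sum>e\<in>cut_arcs G R - B. u e) + (\<Sum>e\<in>B. \<theta>)"
    using assms(2,3) by (intro arg_cong2[of _ _ _ _ "(+)"] sum.cong) (auto simp: min_def intro: antisym)
  finally show ?thesis by (simp add: threshold_value_def algebra_simps)
qed

text \<open>
  As \<open>\<theta>\<close> grows from 0, the number of cut arcs above the threshold passes from at least \<open>\<Gamma>\<close> to at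
  most \<open>\<Gamma>\<close>; connectedness of $[0,\infty)$ yields a threshold where both situations occur.
\<close>

lemma balanced_threshold:
  assumes large: "\<And>R. s \<in> R \<Longrightarrow> t \<notin> R \<Longrightarrow> \<Gamma> \<le> card (cut_arcs G R)"
  obtains \<theta> R1 B1 R2 B2 where "0 \<le> \<theta>"
    "(R1, B1) \<in> threshold_pairs" "card B1 \<le> \<Gamma>" "threshold_value \<Gamma> (R1, B1) \<theta> \<le> Z_LO G u s t \<Gamma>"
    "(R2, B2) \<in> threshold_pairs" "\<Gamma> \<le> card B2" "threshold_value \<Gamma> (R2, B2) \<theta> \<le> Z_LO G u s t \<Gamma>"
proof -
  \<comment> \<open>Pairs with exactly \<Gamma> wide arcs belong to both families.\<close>
  define low where "low = {c \<in> threshold_pairs. card (snd c) \<le> \<Gamma>}"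
  define high where "high = {c \<in> threshold_pairs. \<Gamma> \<le> card (snd c)}"
  define good where "good = (\<lambda>C. \<Union>c\<in>C. {\<theta>. threshold_value \<Gamma> c \<theta> \<le> Z_LO G u s t \<Gamma>})"
  have closed_good: "closed (good C)" if "C \<subseteq> threshold_pairs" for C
    unfolding good_def
  proof (intro closed_UN finite_subset[OF that finite_threshold_pairs] ballI)
    fix c :: "'v set \<times> 'e set"
    show "closed {\<theta>. threshold_value \<Gamma> c \<theta> \<le> Z_LO G u s t \<Gamma>}"
      unfolding threshold_value_def case_prod_unfold
      by (intro closed_Collect_le continuous_intros)
  qed
  have cover: "\<theta> \<in> good low \<union> good high" if \<theta>: "0 \<le> \<theta>" for \<theta>
  proof -
    obtain R where R: "s \<in> R" "t \<notin> R" "R \<subseteq> verts G"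
      "(\<Sum>e\<in>cut_arcs G R. min (u e) \<theta>) - real \<Gamma> * \<theta> \<le> Z_LO G u s t \<Gamma>"
      by (rule threshold_cut[OF \<theta>])
    let ?B = "{e \<in> cut_arcs G R. \<theta> \<le> u e}"
    have "threshold_value \<Gamma> (R, ?B) \<theta> \<le> Z_LO G u s t \<Gamma>"
      using R(4) by (subst min_cut_eq_threshold_value[symmetric]) auto
    moreover have "(R, ?B) \<in> low \<union> high"
      using R by (auto simp: low_def high_def threshold_pairs_def)
    ultimately show ?thesis by (auto simp: good_def)
  qed
  have "0 \<in> good high"
  \<comment> \<open>At threshold 0 all arcs of a cut may count as wide, which leaves the value 0; by
    assumption there are at least \<Gamma> of them.\<close>
  proof -
    obtain R where R: "s \<in> R" "t \<notin> R" "R \<subseteq> verts G" by (rule threshold_cut[OF order_refl])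
    then have "(R, cut_arcs G R) \<in> high" using large by (auto simp: high_def threshold_pairs_def)
    moreover have "threshold_value \<Gamma> (R, cut_arcs G R) 0 \<le> Z_LO G u s t \<Gamma>"
      using Z_LO_nonneg by (simp add: threshold_value_def)
    ultimately show ?thesis by (auto simp: good_def)
  qed
  \<comment> \<open>The total capacity dominates every single one, so at this threshold no arc has
    to count as wide.\<close>
  moreover define \<theta>' where "\<theta>' = (\<Sum>e\<in>arcs G. u e)"
  have \<theta>': "0 \<le> \<theta>'" "\<theta>' \<in> good low"
  proof -
    show "0 \<le> \<theta>'" unfolding \<theta>'_def by (intro sum_nonneg capacity_nonneg)
    then obtain R where R: "s \<in> R" "t \<notin> R" "R \<subseteq> verts G"
      "(\<Sum>e\<in>cut_arcs G R. min (u e) \<theta>') - real \<Gamma> * \<theta>' \<le> Z_LO G u s t \<Gamma>"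
      by (rule threshold_cut)
    have "u e \<le> \<theta>'" if "e \<in> cut_arcs G R" for e
      unfolding \<theta>'_def using that capacity_nonneg by (intro member_le_sum) (auto simp: cut_arcs_def)
    then have "threshold_value \<Gamma> (R, {}) \<theta>' \<le> Z_LO G u s t \<Gamma>"
      using R(4) by (subst min_cut_eq_threshold_value[symmetric]) auto
    moreover have "(R, {}) \<in> low" using R by (auto simp: low_def threshold_pairs_def)
    ultimately show "\<theta>' \<in> good low" by (auto simp: good_def)
  qed
  have "\<exists>\<theta>\<in>{0..}. \<theta> \<in> good low \<inter> good high"
  proof (rule ccontr)
    assume none: "\<not> ?thesis"
    have "closed (good low)" "closed (good high)"
      by (auto intro!: closed_good simp: low_def high_def)
    then have "good low \<inter> {0..} = {} \<or> good high \<inter> {0..} = {}"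
      using cover none by (intro connected_closedD[OF convex_connected[OF convex_real_interval(1)]]) auto
    then show False using \<open>0 \<in> good high\<close> \<theta>' by auto
  qed
  then show ?thesis
    using that by (auto simp: good_def low_def high_def)
qed

text \<open>If some cut has fewer than \<Gamma> arcs, removing it stops all flow. Otherwise a
  balanced threshold provides the two cuts for the random removal.\<close>

lemma Z_RNI_path_le_bound_Z_LO:
  assumes \<Gamma>: "\<Gamma> \<le> card (arcs G)"
  shows "Z_RNI_path G u s t \<Gamma> \<le> LO_ratio_bound \<Gamma> * Z_LO G u s t \<Gamma>"
proof (cases "\<exists>R. s \<in> R \<and> t \<notin> R \<and> card (cut_arcs G R) < \<Gamma>")
  case True
  then obtain R where R: "s \<in> R" "t \<notin> R" "card (cut_arcs G R) < \<Gamma>" by blast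
  then have "Z_RNI_path G u s t \<Gamma> \<le> 0"
    \<comment> \<open>The whole cut is declared wide and nothing is randomized, so the weight
      \<open>q\<close> is 0 and no capacity remains.\<close>
    using Z_RNI_path_le_two_cuts[OF \<Gamma>, of R "cut_arcs G R" 0 R "{}"] by simp
  also have "0 \<le> LO_ratio_bound \<Gamma> * Z_LO G u s t \<Gamma>"
    using LO_ratio_bound_ge_1[of \<Gamma>] Z_LO_nonneg by simp
  finally show ?thesis .
next
  case False
  let ?Z = "Z_LO G u s t \<Gamma>"
  from False have "\<Gamma> \<le> card (cut_arcs G R)" if "s \<in> R" "t \<notin> R" for R
    using that by (meson not_le)
  then obtain \<theta> R1 B1 R2 B2 where *: "0 \<le> \<theta>"
    "(R1, B1) \<in> threshold_pairs" "card B1 \<le> \<Gamma>" "threshold_value \<Gamma> (R1, B1) \<theta> \<le> ?Z"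
    "(R2, B2) \<in> threshold_pairs" "\<Gamma> \<le> card B2" "threshold_value \<Gamma> (R2, B2) \<theta> \<le> ?Z"
    by (rule balanced_threshold)
  define L1 where "L1 = (\<Sum>e\<in>cut_arcs G R1 - B1. u e)"
  define L2 where "L2 = (\<Sum>e\<in>cut_arcs G R2 - B2. u e)"
  define a where "a = \<Gamma> - card B1"
  define b where "b = card B2 - \<Gamma>"
  have a: "a \<le> \<Gamma>" "card B1 + a \<le> \<Gamma>" and b: "card B2 = \<Gamma> + b"
    using * by (auto simp: a_def b_def)
  have L1: "L1 \<le> ?Z + real a * \<theta>"
    using *(3,4) by (simp add: threshold_value_def L1_def a_def of_nat_diff algebra_simps)
  have L2: "L2 + real b * \<theta> \<le> ?Z"
    using *(7) b by (simp add: threshold_value_def L2_def)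
  have L2_nonneg: "0 \<le> L2"
    unfolding L2_def using capacity_nonneg by (intro sum_nonneg) (auto simp: cut_arcs_def)
  have pairs: "s \<in> R1" "t \<notin> R1" "B1 \<subseteq> cut_arcs G R1" "s \<in> R2" "t \<notin> R2" "B2 \<subseteq> cut_arcs G R2"
    using * by (auto simp: threshold_pairs_def)
  show ?thesis
  \<comment> \<open>With exactly \<Gamma> wide arcs in the second cut, the deterministic removal of
    all of them already achieves the LO value.\<close>
  proof (cases "b = 0")
    case True
    have "Z_RNI_path G u s t \<Gamma> \<le> L2"
      using Z_RNI_path_le_two_cuts[OF \<Gamma>, of R2 B2 0 R2 B2] pairs b True by (simp add: L2_def)
    also have "\<dots> \<le> 1 * ?Z" using L2 True by simp
    also have "\<dots> \<le> LO_ratio_bound \<Gamma> * ?Z"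
      using LO_ratio_bound_ge_1 Z_LO_nonneg by (rule mult_right_mono)
    finally show ?thesis .
  next
    case False
    define n where "n = real \<Gamma> + real b"
    define q where "q = real a / n"
    have n: "real \<Gamma> + 1 \<le> n" "0 < n" using False by (simp_all add: n_def)
    have q: "0 \<le> q" "q \<le> 1" "q * n = real a" using a n by (auto simp: q_def)
    \<comment> \<open>The surplus of at least one wide arc bounds \<theta> by the LO value; this
      turns the additive error in \<theta> into a ratio.\<close>
    have "1 * \<theta> \<le> real b * \<theta>" using False *(1) by (intro mult_right_mono) auto
    then have \<theta>: "\<theta> \<le> ?Z" using L2 L2_nonneg by linarith
    have "(1 - q) * real a - q * real b = real a * (real \<Gamma> - real a) / n"
    proof -
      have "n * ((1 - q) * real a - q * real b) = n * real a - (q * n) * (real a + real b)"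
        by (simp add: algebra_simps)
      also have "\<dots> = real a * (real \<Gamma> - real a)"
        unfolding q(3) by (simp add: n_def algebra_simps)
      finally show ?thesis using n by (simp add: field_simps)
    qed
    moreover have "Z_RNI_path G u s t \<Gamma> \<le> (1 - q) * L1 + q * L2"
      using Z_RNI_path_le_two_cuts[OF \<Gamma>, of R1 B1 a R2 B2] pairs a b
      by (simp add: L1_def L2_def q_def n_def)
    moreover have "(1 - q) * L1 + q * L2 \<le> (1 - q) * (?Z + real a * \<theta>) + q * (?Z - real b * \<theta>)"
      using q L1 L2 by (intro add_mono mult_left_mono) auto
    moreover have "(1 - q) * (?Z + real a * \<theta>) + q * (?Z - real b * \<theta>)
        = ?Z + ((1 - q) * real a - q * real b) * \<theta>"
      by (simp add: algebra_simps)
    ultimately have "Z_RNI_path G u s t \<Gamma> \<le> ?Z + real a * (real \<Gamma> - real a) / n * \<theta>" by simp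
    \<comment> \<open>The worst case is one surplus wide arc, \<open>n = \<Gamma> + 1\<close>,
      together with \<open>a\<close> equal to half of \<Gamma>, rounded.\<close>
    also have "real a * (real \<Gamma> - real a) / n
        \<le> real_of_int (\<lfloor>real \<Gamma> / 2\<rfloor> * \<lceil>real \<Gamma> / 2\<rceil>) / (real \<Gamma> + 1)"
      using half_product_bound[of a \<Gamma>] a n half_product_bound[of 0 \<Gamma>] by (intro frac_le) auto
    then have "real a * (real \<Gamma> - real a) / n * \<theta>
        \<le> real_of_int (\<lfloor>real \<Gamma> / 2\<rfloor> * \<lceil>real \<Gamma> / 2\<rceil>) / (real \<Gamma> + 1) * ?Z"
      using \<theta> *(1) half_product_bound[of 0 \<Gamma>] by (intro mult_mono) auto
    finally show ?thesis by (simp add: LO_ratio_bound_def algebra_simps)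
  qed
qed

end

section \<open>Networks with asymptotically worst ratio\<close>

definition two_layer :: "nat \<Rightarrow> nat \<Rightarrow> (nat, nat) pre_digraph" where
  "two_layer n m = \<lparr>verts = {0, 1, 2}, arcs = {..<n + m},
    tail = (\<lambda>e. if e < n then 0 else 1), head = (\<lambda>e. if e < n then 1 else 2)\<rparr>"

lemma two_layer_simps [simp]:
  "verts (two_layer n m) = {0, 1, 2}" "arcs (two_layer n m) = {..<n + m}"
  "tail (two_layer n m) e = (if e < n then 0 else 1)"
  "head (two_layer n m) e = (if e < n then 1 else 2)"
  by (simp_all add: two_layer_def)

lemma in_out_arcs_two_layer [simp]:
  "in_arcs (two_layer n m) 0 = {}" "out_arcs (two_layer n m) 2 = {}"
  "in_arcs (two_layer n m) (Suc 0) = {..<n}" "out_arcs (two_layer n m) (Suc 0) = {n..<n + m}"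
  "in_arcs (two_layer n m) 2 = {n..<n + m}"
  by (auto simp: in_arcs_def out_arcs_def split: if_splits)

lemma flow_network_two_layer:
  assumes "\<And>e. e < n + m \<Longrightarrow> 0 \<le> u e"
  shows "flow_network (two_layer n m) u 0 2"
  by unfold_locales (use assms in auto)

lemma st_paths_two_layer:
  "st_paths (two_layer n m) 0 2 = (\<lambda>(e, f). [e, f]) ` ({..<n} \<times> {n..<n + m})"
proof (intro equalityI subsetI)
  fix p assume "p \<in> st_paths (two_layer n m) 0 2"
  then have p: "pre_digraph.cas (two_layer n m) 0 p 2" "set p \<subseteq> {..<n + m}"
    by (auto simp: st_paths_def pre_digraph.apath_def pre_digraph.awalk_def)
  note cas = pre_digraph.cas.simps
  obtain e q where q: "p = e # q" using p(1) by (cases p) (auto simp: cas)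
  then have e: "e < n" "pre_digraph.cas (two_layer n m) 1 q 2"
    using p(1) by (auto simp: cas split: if_splits)
  obtain f r where r: "q = f # r" using e(2) by (cases q) (auto simp: cas)
  then have f: "\<not> f < n" "pre_digraph.cas (two_layer n m) 2 r 2"
    using e(2) by (auto simp: cas split: if_splits)
  \<comment> \<open>No arc has tail 2, so the walk has to end here.\<close>
  have "r = []" using f(2) by (cases r) (auto simp: cas split: if_splits)
  then show "p \<in> (\<lambda>(e, f). [e, f]) ` ({..<n} \<times> {n..<n + m})"
    using e f p(2) by (auto simp: q r)
next
  fix p assume "p \<in> (\<lambda>(e, f). [e, f]) ` ({..<n} \<times> {n..<n + m})"
  then show "p \<in> st_paths (two_layer n m) 0 2"
    by (auto simp: st_paths_def pre_digraph.apath_def pre_digraph.awalk_def pre_digraph.cas.simps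
        pre_digraph.awalk_verts.simps)
qed

lemma sum_st_paths_two_layer:
  "(\<Sum>p\<in>st_paths (two_layer n m) 0 2. h p) = (\<Sum>e<n. \<Sum>f\<in>{n..<n + m}. h [e, f])"
  unfolding st_paths_two_layer
  by (subst sum.reindex) (auto simp: inj_on_def sum.cartesian_product case_prod_unfold)

text \<open>Each arc of the first layer is used to capacity and its flow is spread evenly over the
  \<open>m\<close> arcs of the second layer, which makes the surviving flow factorize.\<close>

definition even_path_flow :: "nat \<Rightarrow> (nat \<Rightarrow> real) \<Rightarrow> nat list \<Rightarrow> real" where
  "even_path_flow m u p = u (hd p) / real m"

text \<open>An arc of the first layer carries \<open>m\<close> equal shares of its capacity; an arc
  of the second layer carries the average in \<open>second\<close>.\<close>

lemma even_path_flow_feasible: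
  assumes u: "\<And>e. e < n \<Longrightarrow> 0 \<le> u e" and m: "0 < m"
    and second: "\<And>f. f \<in> {n..<n + m} \<Longrightarrow> (\<Sum>e<n. u e) / real m \<le> u f"
  shows "even_path_flow m u \<in> path_flows (two_layer n m) u 0 2"
proof -
  have "(\<Sum>p\<in>{p \<in> st_paths (two_layer n m) 0 2. e \<in> set p}. even_path_flow m u p) \<le> u e"
    if e: "e < n + m" for e
  proof -
    have "finite (st_paths (two_layer n m) 0 2)" by (simp add: st_paths_two_layer)
    then have "(\<Sum>p\<in>{p \<in> st_paths (two_layer n m) 0 2. e \<in> set p}. even_path_flow m u p)
        = (\<Sum>a<n. \<Sum>f\<in>{n..<n + m}. if e \<in> {a, f} then u a / real m else 0)"
      by (simp add: sum.inter_filter sum_st_paths_two_layer even_path_flow_def cong: if_cong)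
    also have "\<dots> \<le> u e"
    proof (cases "e < n")
      case True
      then have "(\<Sum>a<n. \<Sum>f\<in>{n..<n + m}. if e \<in> {a, f} then u a / real m else 0)
          = (\<Sum>a<n. if a = e then u a else 0)"
        using m by (intro sum.cong) auto
      then show ?thesis using True by simp
    next
      case False
      then have "(\<Sum>a<n. \<Sum>f\<in>{n..<n + m}. if e \<in> {a, f} then u a / real m else 0)
          = (\<Sum>a<n. \<Sum>f\<in>{n..<n + m}. if f = e then u a / real m else 0)"
        by (intro sum.cong) auto
      also have "\<dots> = (\<Sum>a<n. u a / real m)"
        using False e by (intro sum.cong) auto
      finally show ?thesis using second[of e] False e by (simp add: sum_divide_distrib)
    qed
    finally show ?thesis .
  qed
  then show ?thesis
    using u by (auto simp: path_flows_def even_path_flow_def st_paths_two_layer)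
qed

text \<open>For 0-1 values, \<open>max 0 (1 - (\<mu> e + \<mu> f))\<close> equals
  \<open>(1 - \<mu> e) * (1 - \<mu> f)\<close>, so the double sum is a product over the
  layers.\<close>

lemma surviving_even_path_flow:
  assumes \<mu>: "\<mu> \<in> interdictions (two_layer n m) \<Gamma>"
  shows "surviving_flow (two_layer n m) 0 2 \<mu> (even_path_flow m u)
    = (\<Sum>e<n. (1 - \<mu> e) * u e) * (\<Sum>f\<in>{n..<n + m}. 1 - \<mu> f) / real m"
proof -
  have \<mu>01: "\<mu> e = 0 \<or> \<mu> e = 1" if "e < n + m" for e
    using \<mu> that by (auto simp: interdictions_def PiE_def Pi_def)
  have "surviving_flow (two_layer n m) 0 2 \<mu> (even_path_flow m u)
      = (\<Sum>e<n. \<Sum>f\<in>{n..<n + m}. (1 - \<mu> e) * u e * ((1 - \<mu> f) / real m))"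
    unfolding surviving_flow_def sum_st_paths_two_layer
  proof (intro sum.cong refl)
    fix e f assume "e \<in> {..<n}" "f \<in> {n..<n + m}"
    then have "e \<noteq> f" "e < n + m" "f < n + m" by auto
    then show "max 0 (1 - (\<Sum>i\<in>set [e, f]. \<mu> i)) * even_path_flow m u [e, f]
        = (1 - \<mu> e) * u e * ((1 - \<mu> f) / real m)"
      using \<mu>01[of e] \<mu>01[of f] by (auto simp: even_path_flow_def)
  qed
  then show ?thesis by (simp add: sum_product sum_divide_distrib)
qed

text \<open>
  The interdictor has to remove all \<open>\<Gamma> - a\<close> wide arcs of the first layer; as its other arcs are tiny for
  large \<open>k\<close>, the remaining budget \<open>a\<close> is best spent in the second layer.
\<close>

definition tight_capacity :: "nat \<Rightarrow> nat \<Rightarrow> nat \<Rightarrow> nat \<Rightarrow> real" where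
  "tight_capacity \<Gamma> a k e =
    (if e < \<Gamma> - a then (real \<Gamma> + 1)\<^sup>2
     else if e < \<Gamma> - a + k * (a + 1) then 1 / real k
     else real (\<Gamma> - a) * (real \<Gamma> + 1)\<^sup>2 + real (a + 1))"

definition tight_digraph :: "nat \<Rightarrow> nat \<Rightarrow> nat \<Rightarrow> (nat, nat) pre_digraph" where
  "tight_digraph \<Gamma> a k = two_layer (\<Gamma> - a + k * (a + 1)) (\<Gamma> + 1)"

lemma flow_network_tight: "flow_network (tight_digraph \<Gamma> a k) (tight_capacity \<Gamma> a k) 0 2"
  unfolding tight_digraph_def by (rule flow_network_two_layer) (simp add: tight_capacity_def)

lemma sum_lessThan_split:
  fixes l n :: nat
  assumes "l \<le> n"
  shows "(\<Sum>e<n. h e) = (\<Sum>e<l. h e) + (\<Sum>e\<in>{l..<n}. h e :: real)"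
  using assms by (metis lessThan_atLeast0 sum.atLeastLessThan_concat zero_le)

text \<open>The second layer bounds the objective by \<theta>, the first one by
  \<open>a + 1 - a * \<theta>\<close>. The former increases and the latter does not, and they meet
  at \<theta> = 1 with value 1, which a flow attains.\<close>

lemma Z_LO_tight:
  assumes a: "a \<le> \<Gamma>" and k: "1 \<le> k"
  shows "Z_LO (tight_digraph \<Gamma> a k) (tight_capacity \<Gamma> a k) 0 2 \<Gamma> = 1"
proof -
  define l where "l = \<Gamma> - a"
  define n where "n = l + k * (a + 1)"
  define m where "m = \<Gamma> + 1"
  have m: "real m = real \<Gamma> + 1" by (simp add: m_def)
  have G: "tight_digraph \<Gamma> a k = two_layer n m"
    by (simp add: tight_digraph_def n_def l_def m_def)
  let ?u = "tight_capacity \<Gamma> a k"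
  interpret flow_network "two_layer n m" ?u 0 2
    using flow_network_tight[of \<Gamma> a k] unfolding G .
  have \<Gamma>: "real \<Gamma> = real l + real a" using a by (simp add: l_def)
  have small: "?u e = 1 / real k" if "e \<in> {l..<n}" for e
    using that by (auto simp: tight_capacity_def n_def l_def)
  have sum_small: "(\<Sum>e\<in>{l..<n}. 1 / real k) = real a + 1"
    using k by (simp add: n_def field_simps)
  have "Z_LO (two_layer n m) ?u 0 2 \<Gamma> \<le> 1"
  proof (rule Z_LO_le)
    fix \<theta> x assume \<theta>: "0 \<le> \<theta>" and x: "x \<in> LO_flows (two_layer n m) ?u 0 2 \<theta>"
    have bound: "x e \<le> ?u e" "x e \<le> \<theta>" if "e < n + m" for e
      using x that by (auto simp: LO_flows_def)
    have balance: "(\<Sum>e\<in>{n..<n + m}. x e) = (\<Sum>e<n. x e)"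
      \<comment> \<open>Vertex 1 is the only one besides source and sink.\<close>
      using x unfolding LO_flows_def by (auto dest!: bspec[of _ _ 1])
    have "(\<Sum>e\<in>{n..<n + m}. x e) \<le> (\<Sum>e\<in>{n..<n + m}. \<theta>)"
      using bound by (intro sum_mono) auto
    then have le1: "(\<Sum>e\<in>{n..<n + m}. x e) \<le> (real \<Gamma> + 1) * \<theta>" by (simp add: m)
    have "(\<Sum>e<n. x e) = (\<Sum>e<l. x e) + (\<Sum>e\<in>{l..<n}. x e)"
      by (rule sum_lessThan_split) (simp add: n_def)
    also have "\<dots> \<le> (\<Sum>e<l. \<theta>) + (\<Sum>e\<in>{l..<n}. 1 / real k)"
    proof (intro add_mono sum_mono)
      show "x e \<le> \<theta>" if "e \<in> {..<l}" for e
        using that by (intro bound(2)) (simp add: n_def)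
      show "x e \<le> 1 / real k" if "e \<in> {l..<n}" for e
        using bound(1)[of e] small[OF that] that by simp
    qed
    finally have le2: "(\<Sum>e\<in>{n..<n + m}. x e) \<le> real l * \<theta> + (real a + 1)"
      unfolding balance sum_small by simp
    have "(\<Sum>e\<in>{n..<n + m}. x e) - real \<Gamma> * \<theta> \<le> 1"
    proof (cases "\<theta> \<le> 1")
      case True
      then show ?thesis using le1 by (simp add: algebra_simps)
    next
      case False
      then have "real a * 1 \<le> real a * \<theta>" by (intro mult_left_mono) auto
      then show ?thesis using le2 unfolding \<Gamma> by (simp add: algebra_simps)
    qed
    then show "(\<Sum>e\<in>in_arcs (two_layer n m) 2. x e) - real \<Gamma> * \<theta> \<le> 1" by simp
  qed
  moreover have "1 \<le> Z_LO (two_layer n m) ?u 0 2 \<Gamma>"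
  proof -
    \<comment> \<open>At \<theta> = 1, narrow arcs are saturated and all others carry one unit; each
      layer then carries \<open>\<Gamma> + 1\<close> in total.\<close>
    define x where "x = (\<lambda>e. if l \<le> e \<and> e < n then 1 / real k else 1)"
    have "(\<Sum>e<n. x e) = (\<Sum>e<l. x e) + (\<Sum>e\<in>{l..<n}. x e)"
      by (rule sum_lessThan_split) (simp add: n_def)
    also have "\<dots> = (\<Sum>e<l. 1) + (\<Sum>e\<in>{l..<n}. 1 / real k)"
      by (intro arg_cong2[of _ _ _ _ "(+)"] sum.cong) (auto simp: x_def)
    also have "\<dots> = real \<Gamma> + 1" unfolding sum_small by (simp add: \<Gamma>)
    finally have in_sum: "(\<Sum>e<n. x e) = real \<Gamma> + 1" .
    have "(\<Sum>e\<in>{n..<n + m}. x e) = (\<Sum>e\<in>{n..<n + m}. 1)"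
      by (rule sum.cong) (auto simp: x_def)
    then have out_sum: "(\<Sum>e\<in>{n..<n + m}. x e) = real \<Gamma> + 1" by (simp add: m)
    have "1 \<le> (real \<Gamma> + 1)\<^sup>2" by simp
    then have "0 \<le> x e \<and> x e \<le> ?u e \<and> x e \<le> 1" for e
      using k by (auto simp: x_def tight_capacity_def l_def n_def add_increasing)
    then have "x \<in> LO_flows (two_layer n m) ?u 0 2 1"
      using in_sum out_sum by (auto simp: LO_flows_def)
    from Z_LO_upper[OF _ this, of \<Gamma>] show ?thesis using out_sum by simp
  qed
  ultimately show ?thesis unfolding G by simp
qed

text \<open>The even flow answers every pure interdiction. The bound charges the remaining budget
  \<open>a\<close> to both layers at once; in the first layer this costs only \<open>a / k\<close>,
  which vanishes for large \<open>k\<close>.\<close>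

lemma Z_RNI_path_tight:
  assumes a: "a \<le> \<Gamma>" and k: "1 \<le> k"
  shows "(real a + 1 - real a / real k) * (real \<Gamma> + 1 - real a) / (real \<Gamma> + 1)
    \<le> Z_RNI_path (tight_digraph \<Gamma> a k) (tight_capacity \<Gamma> a k) 0 2 \<Gamma>"
proof -
  define l where "l = \<Gamma> - a"
  define n where "n = l + k * (a + 1)"
  define m where "m = \<Gamma> + 1"
  have m: "real m = real \<Gamma> + 1" by (simp add: m_def)
  have G: "tight_digraph \<Gamma> a k = two_layer n m"
    by (simp add: tight_digraph_def n_def l_def m_def)
  let ?u = "tight_capacity \<Gamma> a k"
  interpret flow_network "two_layer n m" ?u 0 2
    using flow_network_tight[of \<Gamma> a k] unfolding G .
  have \<Gamma>: "real \<Gamma> = real l + real a" using a by (simp add: l_def)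
  have ln: "l \<le> n" by (simp add: n_def)
  have small: "?u e = 1 / real k" if "e \<in> {l..<n}" for e
    using that by (auto simp: tight_capacity_def n_def l_def)
  have wide: "?u e = (real \<Gamma> + 1)\<^sup>2" if "e < l" for e
    using that by (simp add: tight_capacity_def l_def)
  have u_nonneg: "0 \<le> ?u e" for e by (simp add: tight_capacity_def)
  \<comment> \<open>Each arc of the second layer could carry the whole first layer, so the even flow
    is feasible there.\<close>
  have "(\<Sum>e<n. ?u e) = real l * (real \<Gamma> + 1)\<^sup>2 + real (a + 1)"
    unfolding sum_lessThan_split[OF ln] using k by (simp add: small wide n_def field_simps)
  moreover have "?u f = real l * (real \<Gamma> + 1)\<^sup>2 + real (a + 1)" if "n \<le> f" for f
    using that by (auto simp: tight_capacity_def n_def l_def)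
  ultimately have second: "(\<Sum>e<n. ?u e) = ?u f" if "n \<le> f" for f using that by simp
  have "(\<Sum>e<n. ?u e) / real m \<le> ?u f" if "n \<le> f" for f
    using mult_left_mono[of 1 "real m" "?u f"] u_nonneg[of f]
    by (simp add: second[OF that] divide_le_eq m)
  then have flow: "even_path_flow m ?u \<in> path_flows (two_layer n m) ?u 0 2"
    using u_nonneg by (intro even_path_flow_feasible) (auto simp: m_def)
  have "(real a + 1 - real a / real k) * (real \<Gamma> + 1 - real a) / (real \<Gamma> + 1)
      \<le> surviving_flow (two_layer n m) 0 2 \<mu> (even_path_flow m ?u)"
    if \<mu>: "\<mu> \<in> interdictions (two_layer n m) \<Gamma>" for \<mu>
  proof -
    define P where "P = (\<Sum>e<l. \<mu> e)"
    define I where "I = (\<Sum>e\<in>{l..<n}. \<mu> e)"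
    define J where "J = (\<Sum>f\<in>{n..<n + m}. \<mu> f)"
    have \<mu>01: "\<mu> e = 0 \<or> \<mu> e = 1" if "e < n + m" for e
      using \<mu> that by (auto simp: interdictions_def PiE_def Pi_def)
    then have \<mu>_bounds: "0 \<le> \<mu> e" "\<mu> e \<le> 1" if "e < n + m" for e
      using that by fastforce+
    have total: "P + I + J = real \<Gamma>"
    proof -
      have "(\<Sum>e<n + m. \<mu> e) = real \<Gamma>" using \<mu> by (simp add: interdictions_def)
      then show ?thesis
        using sum_lessThan_split[OF ln, of \<mu>] sum_lessThan_split[of n "n + m" \<mu>]
        by (simp add: P_def I_def J_def)
    qed
    have nonneg: "0 \<le> P" "0 \<le> I" "0 \<le> J"
      unfolding P_def I_def J_def using \<mu>_bounds(1) ln by (auto intro!: sum_nonneg)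
    define A where "A = (\<Sum>e<n. (1 - \<mu> e) * ?u e)"
    have remaining: "(\<Sum>f\<in>{n..<n + m}. 1 - \<mu> f) = real \<Gamma> + 1 - J"
      by (simp add: sum_subtractf J_def m)
    have surviving: "surviving_flow (two_layer n m) 0 2 \<mu> (even_path_flow m ?u)
        = A * (real \<Gamma> + 1 - J) / (real \<Gamma> + 1)"
      using surviving_even_path_flow[OF \<mu>, of ?u] by (simp add: A_def remaining m)
    show ?thesis
    proof (cases "\<exists>e<l. \<mu> e = 0")
      case True
      then obtain e where e: "e < l" "\<mu> e = 0" by blast
      have "(1 - \<mu> e) * ?u e \<le> A"
        unfolding A_def using e ln \<mu>_bounds(2) u_nonneg by (intro member_le_sum) auto
      then have "(real \<Gamma> + 1)\<^sup>2 \<le> A" using e wide by simp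
      \<comment> \<open>An intact wide arc carries \<open>(\<Gamma> + 1)^2\<close>, and at least one
        of the \<open>\<Gamma> + 1\<close> arcs of the second layer is intact. The capacity of wide
        arcs is chosen so that this alone exceeds the claimed bound.\<close>
      then have "(real \<Gamma> + 1)\<^sup>2 * 1 \<le> A * (real \<Gamma> + 1 - J)"
        using total nonneg by (intro mult_mono) (auto intro: order_trans[OF zero_le_power2])
      moreover have "(real a + 1 - real a / real k) * (real \<Gamma> + 1 - real a) \<le> (real \<Gamma> + 1) * (real \<Gamma> + 1)"
        using a divide_nonneg_nonneg[of "real a" "real k"] by (intro mult_mono) linarith+
      ultimately show ?thesis
        unfolding surviving by (intro divide_right_mono) (auto simp: power2_eq_square)
    next
      case False
      then have one: "\<mu> e = 1" if "e < l" for e using \<mu>01[of e] that ln by auto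
      then have "P = real l" by (simp add: P_def)
      \<comment> \<open>Removing all wide arcs leaves exactly \<open>a\<close> units of budget for
        the narrow arcs and the second layer.\<close>
      then have IJ: "I + J = real a" using total \<Gamma> by simp
      have "A = (\<Sum>e\<in>{l..<n}. (1 - \<mu> e) * (1 / real k))"
        unfolding A_def sum_lessThan_split[OF ln] by (simp add: one small)
      also have "\<dots> = (real (k * (a + 1)) - I) / real k"
        unfolding sum_distrib_right[symmetric] by (simp add: sum_subtractf I_def n_def)
      also have "\<dots> = real a + 1 - I / real k"
        using k by (simp add: field_simps)
      finally have A: "A = real a + 1 - I / real k" .
      have "real a / real k \<le> real a" using k by (simp add: divide_le_eq mult_le_cancel_left1)
      moreover have "I / real k \<le> real a / real k"
        using IJ nonneg k by (intro divide_right_mono) auto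
      ultimately have "(real a + 1 - real a / real k) * (real \<Gamma> + 1 - real a) \<le> A * (real \<Gamma> + 1 - J)"
        unfolding A using IJ nonneg a by (intro mult_mono) auto
      then show ?thesis unfolding surviving by (intro divide_right_mono) auto
    qed
  qed
  then show ?thesis
    unfolding G by (intro Z_RNI_path_ge[OF _ flow]) (simp_all add: m_def)
qed

section \<open>The ratio bound and its attainment in the limit\<close>

lemma (in flow_network) ratio_le_LO_ratio_bound:
  assumes "\<Gamma> \<le> card (arcs G)" "Z_LO G u s t \<Gamma> \<noteq> 0"
  shows "Z_RNI_path G u s t \<Gamma> / Z_LO G u s t \<Gamma> \<le> LO_ratio_bound \<Gamma>"
  using Z_RNI_path_le_bound_Z_LO[OF assms(1)] Z_LO_nonneg[of \<Gamma>] assms(2)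
  by (simp add: divide_le_eq)

theorem theorem7:
  shows "(\<forall>(G :: ('v, 'e) pre_digraph) u s t \<Gamma>.
            flow_network G u s t \<and> 1 \<le> \<Gamma> \<and> \<Gamma> \<le> card (arcs G) \<and> Z_LO G u s t \<Gamma> \<noteq> 0 \<longrightarrow>
            Z_RNI_path G u s t \<Gamma> / Z_LO G u s t \<Gamma> \<le> LO_ratio_bound \<Gamma>) \<and>
         (\<forall>\<Gamma>\<ge>1.
            Sup {ereal (Z_RNI_path G u s t \<Gamma> / Z_LO G u s t \<Gamma>) |
                 (G :: (nat, nat) pre_digraph) u s t.
                 flow_network G u s t \<and> \<Gamma> \<le> card (arcs G) \<and> Z_LO G u s t \<Gamma> \<noteq> 0}
            = ereal (LO_ratio_bound \<Gamma>))"
proof (intro conjI allI impI)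
  fix G :: "('v, 'e) pre_digraph" and u s t \<Gamma>
  assume "flow_network G u s t \<and> 1 \<le> \<Gamma> \<and> \<Gamma> \<le> card (arcs G) \<and> Z_LO G u s t \<Gamma> \<noteq> 0"
  then show "Z_RNI_path G u s t \<Gamma> / Z_LO G u s t \<Gamma> \<le> LO_ratio_bound \<Gamma>"
    by (intro flow_network.ratio_le_LO_ratio_bound) simp_all
next
  fix \<Gamma> :: nat assume "1 \<le> \<Gamma>"
  define ratios where "ratios = {ereal (Z_RNI_path G u s t \<Gamma> / Z_LO G u s t \<Gamma>) |
    (G :: (nat, nat) pre_digraph) u s t.
    flow_network G u s t \<and> \<Gamma> \<le> card (arcs G) \<and> Z_LO G u s t \<Gamma> \<noteq> 0}"
  \<comment> \<open>This choice maximizes \<open>a * (\<Gamma> - a)\<close> over the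
    integers.\<close>
  define a where "a = \<Gamma> div 2"
  \<comment> \<open>The LO value of the instances is 1, so \<open>v k\<close> bounds their ratio
    from below. The shift by \<open>Suc\<close> keeps the number of pieces positive.\<close>
  define v where "v = (\<lambda>k. (real a + 1 - real a / real (Suc k)) * (real \<Gamma> + 1 - real a) / (real \<Gamma> + 1))"
  have "Sup ratios = ereal (LO_ratio_bound \<Gamma>)"
  proof (rule antisym)
    show "Sup ratios \<le> ereal (LO_ratio_bound \<Gamma>)"
      unfolding ratios_def
      by (rule Sup_least) (auto intro: flow_network.ratio_le_LO_ratio_bound)
  next
    have "ereal (v k) \<le> Sup ratios" for k
    proof -
      let ?G = "tight_digraph \<Gamma> a (Suc k)" and ?u = "tight_capacity \<Gamma> a (Suc k)"
      have Z: "Z_LO ?G ?u 0 2 \<Gamma> = 1" by (rule Z_LO_tight) (simp_all add: a_def)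
      have "v k \<le> Z_RNI_path ?G ?u 0 2 \<Gamma>"
        unfolding v_def by (rule Z_RNI_path_tight) (simp_all add: a_def)
      then have "ereal (v k) \<le> ereal (Z_RNI_path ?G ?u 0 2 \<Gamma> / Z_LO ?G ?u 0 2 \<Gamma>)"
        by (simp add: Z)
      also have "\<dots> \<le> Sup ratios"
        unfolding ratios_def
        by (rule Sup_upper, intro CollectI exI[of _ ?G] exI[of _ ?u] exI[of _ 0] exI[of _ 2])
          (simp add: Z flow_network_tight, simp add: tight_digraph_def)
      finally show ?thesis .
    qed
    moreover have "v \<longlonglongrightarrow> (real a + 1 - 0) * (real \<Gamma> + 1 - real a) / (real \<Gamma> + 1)"
      unfolding v_def by (intro tendsto_intros LIMSEQ_Suc[OF lim_const_over_n]) simp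
    \<comment> \<open>The identity is \<open>(a + 1) * (\<Gamma> + 1 - a) = (\<Gamma> + 1) + a *
      (\<Gamma> - a)\<close>.\<close>
    moreover have "(real a + 1 - 0) * (real \<Gamma> + 1 - real a) / (real \<Gamma> + 1) = LO_ratio_bound \<Gamma>"
      unfolding LO_ratio_bound_def floor_ceiling_half by (simp add: a_def field_simps)
    ultimately show "ereal (LO_ratio_bound \<Gamma>) \<le> Sup ratios"
      by (intro LIMSEQ_le_const2[of "\<lambda>k. ereal (v k)"]) auto
  qed
  then show "Sup {ereal (Z_RNI_path G u s t \<Gamma> / Z_LO G u s t \<Gamma>) |
      (G :: (nat, nat) pre_digraph) u s t.
      flow_network G u s t \<and> \<Gamma> \<le> card (arcs G) \<and> Z_LO G u s t \<Gamma> \<noteq> 0}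
    = ereal (LO_ratio_bound \<Gamma>)"
    unfolding ratios_def .
qed

end
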